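(* Let $l,J\in\mathbb N_{\ge0}$, and let $V_{l+},V_{l-},V_{J+},V_{J-}$ be the corresponding complex irreducible representations of $\mathrm O(3)$. For $|l-J|\le j\le l+J$ let $K_j:S^2\to\mathrm{Hom}_{\mathbb C}(\mathbb C^{2l+1},\mathbb C^{2J+1})$ be the kernel with matrix elements $$\langle JM|K_j(x)|ln\rangle=\sum_{m=-j}^{j}\langle JM|jm;ln\rangle\cdot\overline{Y_j^m(x)} .$$ Then: (1) a basis of the space of $\mathrm O(3)$-steerable kernels $S^2\to\mathrm{Hom}_{\mathbb C}(V_{l+},V_{J+})$ is given by all $K_j$ with even $j\in\{|l-J|,\dots,l+J\}$; (2) a basis of the space of $\mathrm O(3)$-steerable kernels $S^2\to\mathrm{Hom}_{\mathbb C}(V_{l+},V_{J-})$ is given by all $K_j$ with odd $j\in\{|l-J|,\dots,l+J\}$; (3) a basis of the space of $\mathrm O(3)$-steerable kernels $S^2\to\mathrm{Hom}_{\mathbb C}(V_{l-},V_{J+})$ is given by all $K_j$ with odd $j\in\{|l-J|,\dots,l+J\}$; (4) a basis of the space of $\mathrm O(3)$-steerable kernels $S^2\to\mathrm{Hom}_{\mathbb C}(V_{l-},V_{J-})$ is given by all $K_j$ with even $j\in\{|l-J|,\dots,l+J\}$.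
   Context: $Y_l^n:S^2\to\mathbb C$ ($l\ge0$, $-l\le n\le l$) are the standard complex spherical harmonics, orthonormal with respect to the normalized rotation-invariant measure. $V_l=\mathbb C^{2l+1}$ has standard basis $e^{-l},\dots,e^l$, and the unitary Wigner D-matrices $D_l(g)$, $g\in\mathrm{SO}(3)$, satisfy $Y_l^n(g^{-1}x)=\sum_{n'}D_l^{n'n}(g)Y_l^{n'}(x)$. Every element of $\mathrm O(3)$ is uniquely $sg$ with $s\in\{\pm1\}$, $g\in\mathrm{SO}(3)$. The representations $D_{l\pm}:\mathrm O(3)\to\mathrm U(V_{l\pm})$, $V_{l\pm}=\mathbb C^{2l+1}$, are $D_{l+}(sg)=D_l(g)$ and $D_{l-}(sg)=sD_l(g)$; these are up to equivalence all complex irreducible representations of $\mathrm O(3)$. For $|l-j|\le J\le l+j$ the Clebsch-Gordan coefficients are $\langle JM|jm;ln\rangle=\langle\iota(e^M)|e^m\otimes e^n\rangle$, with $\iota:V_J\to V_j\otimes V_l$ a fixed $\mathrm{SO}(3)$-equivariant linear isometric embedding (unique up to phase), inner products being antilinear in the first argument. Matrix elements: $\langle JM|f|ln\rangle=\langle e^M|f(e^n)\rangle$. A steerable kernel between representations $\rho_{\mathrm{in}},\rho_{\mathrm{out}}$ of $\mathrm O(3)$ is any function $K$ on $S^2$ with values in linear maps such that $K(hx)=\rho_{\mathrm{out}}(h)\circ K(x)\circ\rho_{\mathrm{in}}(h)^{-1}$ for all $h\in\mathrm O(3),x\in S^2$. *)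

theory Defs
  imports
    "HOL-Analysis.Analysis"
    "HOL-Computational_Algebra.Polynomial"
    "HOL-Library.Function_Algebras"
begin

section \<open>Finite-dimensional coordinate spaces with arbitrary index sets\<close>

text \<open>
  The space with standard basis indexed by a finite set \<open>I\<close> consists of the functions
  supported in \<open>I\<close>.  Linear maps out of it are total functions that vanish off the space, so
  that equality of linear maps is equality of functions and their vector space operations are
  the pointwise ones.
\<close>

definition coord_space :: "'i set \<Rightarrow> ('i \<Rightarrow> complex) set" where
  "coord_space I = {v. \<forall>i. i \<notin> I \<longrightarrow> v i = 0}"

definition std_basis :: "'i \<Rightarrow> 'i \<Rightarrow> complex" where
  "std_basis i = (\<lambda>k. if k = i then 1 else 0)"

definition herm_inner :: "'i set \<Rightarrow> ('i \<Rightarrow> complex) \<Rightarrow> ('i \<Rightarrow> complex) \<Rightarrow> complex" where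
  "herm_inner I v w = (\<Sum>i\<in>I. cnj (v i) * w i)"

definition Hom :: "'i set \<Rightarrow> 'k set \<Rightarrow> (('i \<Rightarrow> complex) \<Rightarrow> ('k \<Rightarrow> complex)) set" where
  "Hom I K = {f.
     (\<forall>v\<in>coord_space I. f v \<in> coord_space K) \<and>
     (\<forall>v\<in>coord_space I. \<forall>w\<in>coord_space I. f (\<lambda>i. v i + w i) = (\<lambda>k. f v k + f w k)) \<and>
     (\<forall>c. \<forall>v\<in>coord_space I. f (\<lambda>i. c * v i) = (\<lambda>k. c * f v k)) \<and>
     (\<forall>v. v \<notin> coord_space I \<longrightarrow> f v = (\<lambda>k. 0))}"

definition mat_elem :: "'k set \<Rightarrow> 'k \<Rightarrow> (('i \<Rightarrow> complex) \<Rightarrow> ('k \<Rightarrow> complex)) \<Rightarrow> 'i \<Rightarrow> complex" where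
  "mat_elem K k f i = herm_inner K (std_basis k) (f (std_basis i))"

definition lin_map ::
    "'i set \<Rightarrow> 'k set \<Rightarrow> ('k \<Rightarrow> 'i \<Rightarrow> complex) \<Rightarrow> ('i \<Rightarrow> complex) \<Rightarrow> ('k \<Rightarrow> complex)" where
  "lin_map I K A = (\<lambda>v k. if v \<in> coord_space I \<and> k \<in> K then \<Sum>i\<in>I. A k i * v i else 0)"

lemma lin_map_in_Hom: "lin_map I K A \<in> Hom I K"
  by (auto simp: Hom_def lin_map_def coord_space_def fun_eq_iff sum.distrib sum_distrib_left
      algebra_simps)

lemma mat_elem_lin_map:
  assumes "finite I" "finite K" "i \<in> I" "k \<in> K"
  shows "mat_elem K k (lin_map I K A) i = A k i"
proof -
  have "lin_map I K A (std_basis i) k = A k i"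
    using assms by (auto simp: lin_map_def std_basis_def coord_space_def if_distrib cong: if_cong)
  then show ?thesis
    using assms
    by (simp add: mat_elem_def herm_inner_def std_basis_def if_distrib if_distribR cong: if_cong)
qed

definition tensor :: "('i \<Rightarrow> complex) \<Rightarrow> ('k \<Rightarrow> complex) \<Rightarrow> 'i \<times> 'k \<Rightarrow> complex" where
  "tensor v w = (\<lambda>(i, k). v i * w k)"


section \<open>Spherical harmonics\<close>

abbreviation S2 :: "(real^3) set" where
  "S2 \<equiv> sphere 0 1"

definition legendre :: "nat \<Rightarrow> real poly" where
  "legendre l = smult (1 / (2 ^ l * fact l)) ((pderiv ^^ l) ([:- 1, 0, 1:] ^ l))"

text \<open>
  Condon-Shortley convention.  On the sphere \<open>sin \<theta> ^ m * cis (m * \<phi>) = (x + \<i> y) ^ m\<close>, so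
  the factor \<open>(1 - z\<^sup>2) powr (m / 2)\<close> of the associated Legendre function
  and the azimuthal phase combine to a power of \<open>Complex x y\<close>.  The usual factor
  \<open>1 / (4 * pi)\<close> is absent since the measure on the sphere is normalized to total mass 1.
\<close>

definition sph_harm_nonneg :: "nat \<Rightarrow> nat \<Rightarrow> real^3 \<Rightarrow> complex" where
  "sph_harm_nonneg l m x =
     of_real ((- 1) ^ m * sqrt ((2 * real l + 1) * fact (l - m) / fact (l + m))
              * poly ((pderiv ^^ m) (legendre l)) (x $ 3))
     * Complex (x $ 1) (x $ 2) ^ m"

definition sph_harm :: "nat \<Rightarrow> int \<Rightarrow> real^3 \<Rightarrow> complex" where
  "sph_harm l n x =
     (if 0 \<le> n then sph_harm_nonneg l (nat n) x
      else (- 1) ^ nat (- n) * cnj (sph_harm_nonneg l (nat (- n)) x))"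

lemma sph_harm_spherical_coordinates:
  "sph_harm l (int m) (vector [sin \<theta> * cos \<phi>, sin \<theta> * sin \<phi>, cos \<theta>]) =
     of_real (sqrt ((2 * real l + 1) * fact (l - m) / fact (l + m))
       * ((- 1) ^ m * sin \<theta> ^ m * poly ((pderiv ^^ m) (legendre l)) (cos \<theta>)))
     * cis (real m * \<phi>)"
proof -
  have "Complex (sin \<theta> * cos \<phi>) (sin \<theta> * sin \<phi>) = of_real (sin \<theta>) * cis \<phi>"
    by (simp add: complex_eq_iff)
  then have "Complex (sin \<theta> * cos \<phi>) (sin \<theta> * sin \<phi>) ^ m
      = of_real (sin \<theta> ^ m) * cis (real m * \<phi>)"
    by (simp add: power_mult_distrib Complex.DeMoivre)
  then show ?thesis
    by (simp add: sph_harm_def sph_harm_nonneg_def)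
qed


section \<open>Representations of the rotation group and of the orthogonal group\<close>

definition idx :: "nat \<Rightarrow> int set" where
  "idx l = {- int l..int l}"

definition SO3 :: "(real^3^3) set" where
  "SO3 = {g. rotation_matrix g}"

definition O3 :: "(real^3^3) set" where
  "O3 = {h. orthogonal_matrix h}"

text \<open>The matrix entry \<open>wigner_D l g n' n\<close> is written with the row index first.\<close>

definition wigner_D :: "nat \<Rightarrow> real^3^3 \<Rightarrow> int \<Rightarrow> int \<Rightarrow> complex" where
  "wigner_D l g = (THE D.
     (\<forall>n' n. n' \<notin> idx l \<or> n \<notin> idx l \<longrightarrow> D n' n = 0) \<and>
     (\<forall>n\<in>idx l. \<forall>x\<in>S2.
        sph_harm l n (matrix_inv g *v x) = (\<Sum>n'\<in>idx l. D n' n * sph_harm l n' x)))"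

definition D_map :: "nat \<Rightarrow> real^3^3 \<Rightarrow> (int \<Rightarrow> complex) \<Rightarrow> (int \<Rightarrow> complex)" where
  "D_map l g = lin_map (idx l) (idx l) (wigner_D l g)"

definition D_tensor_map ::
    "nat \<Rightarrow> nat \<Rightarrow> real^3^3 \<Rightarrow> (int \<times> int \<Rightarrow> complex) \<Rightarrow> (int \<times> int \<Rightarrow> complex)" where
  "D_tensor_map j l g = lin_map (idx j \<times> idx l) (idx j \<times> idx l)
     (\<lambda>(m', n') (m, n). wigner_D j g m' m * wigner_D l g n' n)"

text \<open>
  Writing \<open>h = s g\<close> with \<open>s = \<plusminus>1\<close> and \<open>g\<close> a rotation forces \<open>s = det h\<close> and \<open>g = s h\<close>.
\<close>

definition rep_plus :: "nat \<Rightarrow> real^3^3 \<Rightarrow> (int \<Rightarrow> complex) \<Rightarrow> (int \<Rightarrow> complex)" where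
  "rep_plus l h = D_map l (det h *\<^sub>R h)"

definition rep_minus :: "nat \<Rightarrow> real^3^3 \<Rightarrow> (int \<Rightarrow> complex) \<Rightarrow> (int \<Rightarrow> complex)" where
  "rep_minus l h = (\<lambda>v n. of_real (det h) * D_map l (det h *\<^sub>R h) v n)"

lemma rep_sign_rotation:
  assumes "g \<in> SO3" and "s = 1 \<or> s = - 1"
  shows "s *\<^sub>R g \<in> O3"
    and "rep_plus l (s *\<^sub>R g) = D_map l g"
    and "rep_minus l (s *\<^sub>R g) = (\<lambda>v n. of_real s * D_map l g v n)"
proof -
  have det: "det (s *\<^sub>R g) = s"
  proof -
    have "det (- g) = - det g"
      by (simp add: det_3)
    then show ?thesis
      using assms by (auto simp: SO3_def rotation_matrix_def)
  qed
  have "transpose (- g) = - transpose g"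
    by (simp add: transpose_def vec_eq_iff)
  then have "orthogonal_matrix (- g)" if "orthogonal_matrix g"
    using that by (simp add: orthogonal_matrix_def matrix_matrix_mult_def vec_eq_iff)
  then show "s *\<^sub>R g \<in> O3"
    using assms by (auto simp: SO3_def O3_def rotation_matrix_def)
  show "rep_plus l (s *\<^sub>R g) = D_map l g"
    using assms det by (auto simp: rep_plus_def)
  show "rep_minus l (s *\<^sub>R g) = (\<lambda>v n. of_real s * D_map l g v n)"
    using assms det by (auto simp: rep_minus_def)
qed


section \<open>Clebsch-Gordan coefficients\<close>

definition CG_embedding ::
    "nat \<Rightarrow> nat \<Rightarrow> nat \<Rightarrow> ((int \<Rightarrow> complex) \<Rightarrow> (int \<times> int \<Rightarrow> complex)) \<Rightarrow> bool" where
  "CG_embedding J j l \<iota> \<longleftrightarrow>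
     \<iota> \<in> Hom (idx J) (idx j \<times> idx l) \<and>
     (\<forall>v\<in>coord_space (idx J). \<forall>w\<in>coord_space (idx J).
        herm_inner (idx j \<times> idx l) (\<iota> v) (\<iota> w) = herm_inner (idx J) v w) \<and>
     (\<forall>g\<in>SO3. \<forall>v\<in>coord_space (idx J). \<iota> (D_map J g v) = D_tensor_map j l g (\<iota> v))"

definition clebsch_gordan ::
    "nat \<Rightarrow> nat \<Rightarrow> ((int \<Rightarrow> complex) \<Rightarrow> (int \<times> int \<Rightarrow> complex)) \<Rightarrow> int \<Rightarrow> int \<Rightarrow> int \<Rightarrow> complex" where
  "clebsch_gordan j l \<iota> M m n =
     herm_inner (idx j \<times> idx l) (\<iota> (std_basis M)) (tensor (std_basis m) (std_basis n))"


section \<open>Steerable kernels\<close>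

text \<open>
  A kernel on the sphere is a function on the ambient space that vanishes off the sphere.
\<close>

type_synonym kernel = "real^3 \<Rightarrow> (int \<Rightarrow> complex) \<Rightarrow> (int \<Rightarrow> complex)"

definition steerable_kernels ::
    "nat \<Rightarrow> nat \<Rightarrow> (real^3^3 \<Rightarrow> (int \<Rightarrow> complex) \<Rightarrow> (int \<Rightarrow> complex))
       \<Rightarrow> (real^3^3 \<Rightarrow> (int \<Rightarrow> complex) \<Rightarrow> (int \<Rightarrow> complex)) \<Rightarrow> kernel set" where
  "steerable_kernels l J \<rho>_in \<rho>_out = {K.
     (\<forall>x. x \<notin> S2 \<longrightarrow> K x = (\<lambda>v M. 0)) \<and>
     (\<forall>x\<in>S2. K x \<in> Hom (idx l) (idx J)) \<and>
     (\<forall>h\<in>O3. \<forall>x\<in>S2. \<forall>v\<in>coord_space (idx l).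
        K (h *v x) v = (\<rho>_out h \<circ> K x \<circ> inv_into (coord_space (idx l)) (\<rho>_in h)) v)}"

definition CG_kernel ::
    "nat \<Rightarrow> nat \<Rightarrow> nat \<Rightarrow> ((int \<Rightarrow> complex) \<Rightarrow> (int \<times> int \<Rightarrow> complex)) \<Rightarrow> kernel" where
  "CG_kernel l J j \<iota> x =
     (if x \<in> S2
      then lin_map (idx l) (idx J)
             (\<lambda>M n. \<Sum>m\<in>idx j. clebsch_gordan j l \<iota> M m n * cnj (sph_harm j m x))
      else (\<lambda>v M. 0))"

lemma mat_elem_CG_kernel:
  assumes "x \<in> S2" "M \<in> idx J" "n \<in> idx l"
  shows "mat_elem (idx J) M (CG_kernel l J j \<iota> x) n =
    (\<Sum>m\<in>idx j. clebsch_gordan j l \<iota> M m n * cnj (sph_harm j m x))"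
  using assms by (simp add: CG_kernel_def mat_elem_lin_map idx_def)

definition kernel_scale :: "complex \<Rightarrow> kernel \<Rightarrow> kernel" where
  "kernel_scale c K = (\<lambda>x v M. c * K x v M)"

global_interpretation kernel: vector_space kernel_scale
  by unfold_locales (auto simp: kernel_scale_def fun_eq_iff algebra_simps)

definition is_basis :: "'j set \<Rightarrow> ('j \<Rightarrow> kernel) \<Rightarrow> kernel set \<Rightarrow> bool" where
  "is_basis A B W \<longleftrightarrow>
     inj_on B A \<and> kernel.independent (B ` A) \<and> kernel.span (B ` A) = W"

end

theory Submission
  imports Defs
begin

text \<open>
  An \<open>SO(3)\<close>-steerable kernel is determined by its value at the north pole, and that value commutes
  with the rotations about the polar axis, hence is diagonal. So these kernels form a space of dimension at
  most \<open>2 min l J + 1\<close>, which is the number of admissible \<open>j\<close>. The kernels \<open>K\<^sub>j\<close> are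
  \<open>SO(3)\<close>-steerable, by the equivariance of the embedding and the unitarity of the Wigner matrices,
  and linearly independent, since the spherical harmonics are; hence they form a basis of the
  \<open>SO(3)\<close>-steerable kernels. The central element \<open>-1\<close> of \<open>O(3)\<close> prescribes the parity of
  the kernel in \<open>x\<close>, and \<open>K\<^sub>j\<close> has the parity of \<open>j\<close>.

  Existence and unitarity of the Wigner matrices come from the generating function: up to binomial
  weights, the \<open>Y\<^sub>l\<^sup>n(x)\<close> are the coefficients of the \<open>l\<close>-th power of the quadratic polynomial
  \<open>cnj w + 2 z t - w t\<^sup>2\<close> with \<open>w = x\<^sub>1 + \<i> x\<^sub>2\<close> and \<open>z = x\<^sub>3\<close>. A rotation by \<open>\<beta>\<close> about the
  second axis acts on it as a linear substitution through the half angle, and rotations about the second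
  and third axes generate \<open>SO(3)\<close>.
\<close>

section \<open>Spherical harmonics as coefficients of a quadratic power\<close>

text \<open>The polynomial \<open>p\<close>, read as a binary form of degree \<open>N\<close>, evaluated at \<open>(u, v)\<close>.\<close>

definition homog :: "nat \<Rightarrow> complex poly \<Rightarrow> complex poly \<Rightarrow> complex poly \<Rightarrow> complex poly" where
  "homog N p u v = (\<Sum>k\<le>N. smult (coeff p k) (u ^ k * v ^ (N - k)))"

lemma homog_add: "homog N (p + q) u v = homog N p u v + homog N q u v"
  by (simp add: homog_def smult_add_left sum.distrib)

lemma homog_smult: "homog N (smult c p) u v = smult c (homog N p u v)"
  by (intro poly_eqI) (simp add: homog_def coeff_sum sum_distrib_left mult.assoc)

lemma homog_pCons_0: "homog (Suc N) (pCons 0 p) u v = u * homog N p u v"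
  unfolding homog_def
  by (subst sum.atMost_Suc_shift) (simp add: sum_distrib_left mult.assoc)

text \<open>The coefficient of degree \<open>Suc N\<close> vanishes, and every other term gains one
  factor \<open>v\<close>.\<close>

lemma homog_Suc:
  assumes "degree p \<le> N"
  shows "homog (Suc N) p u v = v * homog N p u v"
proof -
  have "coeff p (Suc N) = 0"
    using assms by (simp add: coeff_eq_0)
  moreover have "smult (coeff p k) (u ^ k * v ^ (Suc N - k)) = v * smult (coeff p k) (u ^ k * v ^ (N - k))" if "k \<le> N" for k
    using that by (simp add: Suc_diff_le mult.left_commute)
  ultimately show ?thesis
    unfolding homog_def sum_distrib_left by simp
qed

text \<open>Homogenization is multiplicative. For a quadratic factor the product splits into shifts
  \<open>pCons 0\<close>, each contributing a factor \<open>u\<close>; missing degrees are made up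
  by factors \<open>v\<close>.\<close>

lemma homog_quadratic_mult:
  assumes "degree p \<le> N"
  shows "homog (Suc (Suc N)) ([:c, b, a:] * p) u v
    = (smult a (u ^ 2) + smult b (u * v) + smult c (v ^ 2)) * homog N p u v"
proof -
  have "[:c, b, a:] * p = smult c p + pCons 0 (smult b p) + pCons 0 (pCons 0 (smult a p))"
    by (simp add: algebra_simps)
  moreover have "degree (smult c p) \<le> Suc N" "degree p \<le> Suc N"
    "degree (pCons 0 (smult b p)) \<le> Suc N"
    using assms by (auto intro: order.trans[OF degree_pCons_le])
  ultimately show ?thesis
    using assms
    by (simp add: homog_add homog_pCons_0 homog_smult homog_Suc power2_eq_square algebra_simps)
qed

lemma degree_quadratic_power: "degree ([:c, b, a:] ^ l :: complex poly) \<le> 2 * l"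
proof -
  have "degree [:c, b, a:] \<le> 2"
    by simp
  then show ?thesis
    using degree_power_le[of "[:c, b, a:]" l] by (meson le_trans mult_le_mono1)
qed

lemma homog_quadratic_power:
  "homog (2 * l) ([:c, b, a:] ^ l) u v = (smult a (u ^ 2) + smult b (u * v) + smult c (v ^ 2)) ^ l"
proof (induction l)
  case 0
  show ?case by (simp add: homog_def)
next
  case (Suc l)
  then show ?case
    using homog_quadratic_mult[OF degree_quadratic_power] by simp
qed

text \<open>Setting \<open>u = 1\<close> and \<open>v\<close> to the indeterminate reverses the
  coefficients of a form of degree \<open>2 * l\<close>.\<close>

lemma coeff_quadratic_power_reverse:
  assumes "k \<le> 2 * l"
  shows "coeff ([:a, b, c:] ^ l :: complex poly) (2 * l - k) = coeff ([:c, b, a:] ^ l) k"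
proof -
  have "[:a, b, c:] ^ l = homog (2 * l) ([:c, b, a:] ^ l) 1 [:0, 1:]"
    by (subst homog_quadratic_power) (simp add: power2_eq_square)
  also have "\<dots> = (\<Sum>i\<le>2 * l. monom (coeff ([:c, b, a:] ^ l) i) (2 * l - i))"
    by (simp add: homog_def monom_altdef)
  finally have "coeff ([:a, b, c:] ^ l) (2 * l - k)
      = (\<Sum>i\<le>2 * l. if 2 * l - i = 2 * l - k then coeff ([:c, b, a:] ^ l) i else 0)"
    by (simp add: coeff_sum)
  also have "\<dots> = (\<Sum>i\<le>2 * l. if i = k then coeff ([:c, b, a:] ^ l) i else 0)"
    using assms by (intro sum.cong) auto
  finally show ?thesis
    using assms by simp
qed

section \<open>Taylor coefficients, and real polynomials read over the complex numbers\<close>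

lemma pcompose_power: "(p ^ n) \<circ>\<^sub>p q = (p \<circ>\<^sub>p q :: 'a::comm_ring_1 poly) ^ n"
  by (induction n) (simp_all add: pcompose_mult pcompose_1)

lemma coeff_eq_higher_pderiv:
  "coeff (p :: 'a::field_char_0 poly) k = poly ((pderiv ^^ k) p) 0 / fact k"
  using coeff_higher_pderiv[of k p 0] by (simp add: poly_0_coeff_0 flip: pochhammer_fact)

lemma higher_pderiv_pcompose_linear:
  "(pderiv ^^ k) (p \<circ>\<^sub>p [:a, b:]) = smult (b ^ k) ((pderiv ^^ k) p \<circ>\<^sub>p [:a, b :: complex:])"
  by (induction k) (simp_all add: pderiv_smult pderiv_pcompose pderiv_pCons mult.commute)

text \<open>Taylor expansion at \<open>a\<close> in the variable \<open>b * t\<close>.\<close>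

lemma coeff_pcompose_linear:
  "coeff (p \<circ>\<^sub>p [:a, b :: complex:]) k = b ^ k * poly ((pderiv ^^ k) p) a / fact k"
  by (simp add: coeff_eq_higher_pderiv higher_pderiv_pcompose_linear poly_pcompose)

lemma higher_pderiv_of_real:
  "(pderiv ^^ k) (map_poly of_real p) = map_poly (of_real :: real \<Rightarrow> complex) ((pderiv ^^ k) p)"
proof (induction k)
  case (Suc k)
  have "pderiv (map_poly of_real q) = map_poly (of_real :: real \<Rightarrow> complex) (pderiv q)" for q
    by (intro poly_eqI) (simp add: coeff_map_poly coeff_pderiv)
  with Suc show ?case by simp
qed simp

lemma map_poly_of_real_mult:
  "map_poly (of_real :: real \<Rightarrow> complex) (p * q) = map_poly of_real p * map_poly of_real q"
  by (intro poly_eqI) (simp add: coeff_map_poly coeff_mult)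

lemma map_poly_of_real_power:
  "map_poly (of_real :: real \<Rightarrow> complex) (p ^ n) = map_poly of_real p ^ n"
  by (induction n) (simp_all add: map_poly_of_real_mult map_poly_1')

lemma poly_map_poly_of_real: "poly (map_poly of_real p) (of_real z :: complex) = of_real (poly p z)"
  by (induction p) (simp_all add: map_poly_pCons)

section \<open>The null quadric and the spherical harmonics as its weighted coefficients\<close>

abbreviation plane :: "real^3 \<Rightarrow> complex" where
  "plane x \<equiv> Complex (x $ 1) (x $ 2)"

text \<open>The pairing of \<open>x\<close> with the vector
  \<open>(1 - t^2, - \<i> (1 + t^2), 2 t)\<close>, whose bilinear square is zero; powers of such a
  pairing are harmonic polynomials in \<open>x\<close>.\<close>

definition null_quadric :: "real^3 \<Rightarrow> complex poly" where
  "null_quadric x = [:cnj (plane x), of_real (2 * x $ 3), - plane x:]"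

lemma S2_iff: "x \<in> S2 \<longleftrightarrow> (x $ 1)\<^sup>2 + (x $ 2)\<^sup>2 + (x $ 3)\<^sup>2 = 1"
  by (simp only: mem_sphere dist_0_norm norm_eq_1 inner_vec_def sum_3 inner_real_def power2_eq_square)

lemma plane_mult_cnj:
  assumes "x \<in> S2"
  shows "plane x * cnj (plane x) = 1 - (of_real (x $ 3))\<^sup>2"
  using assms[unfolded S2_iff] by (simp add: complex_eq_iff power2_eq_square algebra_simps)

text \<open>By Rodrigues' formula, the value at \<open>k = l + m\<close> is
  \<open>2 ^ l * fact l\<close> times the \<open>m\<close>-th derivative of the Legendre
  polynomial.\<close>

definition rodrigues :: "nat \<Rightarrow> nat \<Rightarrow> real \<Rightarrow> complex" where
  "rodrigues l k z = of_real (poly ((pderiv ^^ k) ([:- 1, 0, 1:] ^ l)) z)"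

lemma rodrigues_taylor:
  "coeff (([:- 1, 0, 1:] ^ l) \<circ>\<^sub>p [:of_real z, b :: complex:]) k = b ^ k * rodrigues l k z / fact k"
proof -
  have "([:- 1, 0, 1:] ^ l :: complex poly) = map_poly of_real ([:- 1, 0, 1:] ^ l)"
    by (simp add: map_poly_of_real_power map_poly_pCons)
  then show ?thesis
    by (simp only: coeff_pcompose_linear higher_pderiv_of_real poly_map_poly_of_real rodrigues_def)
qed

lemma coeff_null_quadric_power:
  assumes "x \<in> S2"
  shows "coeff (null_quadric x ^ l) (l + m)
    = (- 1) ^ m * plane x ^ m * rodrigues l (l + m) (x $ 3) / fact (l + m)"
proof (cases "plane x = 0")
  case False
  let ?z = "of_real (x $ 3) :: complex"
  \<comment> \<open>On the sphere \<open>w Q(t) = 1 - (z - w t)\<^sup>2\<close>, so the coefficients of \<open>Q ^ l\<close> are Taylor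
    coefficients of \<open>(z\<^sup>2 - 1) ^ l\<close>, to which Rodrigues' formula relates the Legendre functions.\<close>
  have "[:plane x:] * null_quadric x = [:-1:] * ([:- 1, 0, 1:] \<circ>\<^sub>p [:?z, - plane x:])"
    using plane_mult_cnj[OF assms]
    by (simp add: null_quadric_def pcompose_pCons power2_eq_square algebra_simps)
  then have "([:plane x:] * null_quadric x) ^ l = ([:-1:] * ([:- 1, 0, 1:] \<circ>\<^sub>p [:?z, - plane x:])) ^ l"
    by simp
  then have "smult (plane x ^ l) (null_quadric x ^ l)
      = smult ((-1) ^ l) (([:- 1, 0, 1:] ^ l) \<circ>\<^sub>p [:?z, - plane x:])"
    unfolding power_mult_distrib by (simp add: poly_const_pow pcompose_power)
  then have "coeff (smult (plane x ^ l) (null_quadric x ^ l)) (l + m)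
      = (-1) ^ l * ((- plane x) ^ (l + m) * rodrigues l (l + m) (x $ 3) / fact (l + m))"
    by (simp add: rodrigues_taylor)
  also have "\<dots> = plane x ^ l * ((- 1) ^ m * plane x ^ m * rodrigues l (l + m) (x $ 3) / fact (l + m))"
    by (simp add: power_minus[of "plane x"] power_add)
  finally show ?thesis
    using False by (metis coeff_smult mult_cancel_left power_not_zero)
next
  \<comment> \<open>At the poles \<open>plane x\<close> cannot be cancelled. There the quadric is
    the monomial \<open>2 * z * t\<close>, and both sides vanish unless \<open>m = 0\<close>. Since
    \<open>z^2 = 1\<close>, the remaining Taylor coefficient is read off from
    \<open>(z + t)^2 - 1 = t * (2 * z + t)\<close>.\<close>
  case True
  let ?z = "of_real (x $ 3) :: complex"
  have z: "?z * ?z = 1"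
    using plane_mult_cnj[OF assms] True by (simp add: power2_eq_square)
  have "[:- 1, 0, 1:] \<circ>\<^sub>p [:?z, 1:] = [:0, 1:] * [:2 * ?z, 1:]"
    using z by (simp add: pcompose_pCons)
  then have "([:- 1, 0, 1:] ^ l) \<circ>\<^sub>p [:?z, 1:] = [:0, 1:] ^ l * [:2 * ?z, 1:] ^ l"
    by (simp add: pcompose_power flip: power_mult_distrib)
  also have "\<dots> = monom 1 l * [:2 * ?z, 1:] ^ l"
    by (simp add: monom_altdef)
  finally have "rodrigues l l (x $ 3) / fact l = coeff (monom 1 l * [:2 * ?z, 1:] ^ l) l"
    using rodrigues_taylor[of l "x $ 3" 1 l] by simp
  also have "\<dots> = (2 * ?z) ^ l"
    by (simp add: coeff_monom_mult flip: poly_0_coeff_0)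
  finally have R: "rodrigues l l (x $ 3) / fact l = (2 * ?z) ^ l" .
  have "null_quadric x = [:0, 2 * ?z:]"
    using True by (simp add: null_quadric_def)
  also have "\<dots> = smult (2 * ?z) [:0, 1:]"
    by simp
  finally have "null_quadric x ^ l = monom ((2 * ?z) ^ l) l"
    by (simp only: smult_power monom_altdef)
  then show ?thesis
    using True R by (cases "m = 0") simp_all
qed

text \<open>Rodrigues' formula supplies the derivatives of \<open>legendre l\<close>. The factor
  \<open>1 / fact (l + m)\<close> of the Taylor coefficient turns the quotient of factorials under
  the root into a product.\<close>

lemma sph_harm_nonneg_coeff:
  assumes "x \<in> S2" "m \<le> l"
  shows "sph_harm_nonneg l m x
    = of_real (sqrt ((2 * real l + 1) * fact (l - m) * fact (l + m)) / (2 ^ l * fact l))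
        * coeff (null_quadric x ^ l) (l + m)"
proof -
  have "(pderiv ^^ m) (legendre l)
      = smult (1 / (2 ^ l * fact l)) ((pderiv ^^ (l + m)) ([:- 1, 0, 1:] ^ l))"
    by (simp add: legendre_def higher_pderiv_smult add.commute[of l] funpow_add)
  then have P: "of_real (poly ((pderiv ^^ m) (legendre l)) (x $ 3))
      = rodrigues l (l + m) (x $ 3) / (2 ^ l * fact l)"
    by (simp add: rodrigues_def)
  have S: "sqrt ((2 * real l + 1) * fact (l - m) * fact (l + m)) / fact (l + m)
      = sqrt ((2 * real l + 1) * fact (l - m) / fact (l + m))"
  proof -
    have "sqrt ((2 * real l + 1) * fact (l - m) * fact (l + m))
        = sqrt ((2 * real l + 1) * fact (l - m) / fact (l + m) * (fact (l + m))\<^sup>2)"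
      by (simp add: power2_eq_square)
    then show ?thesis
      by (simp only: real_sqrt_mult real_sqrt_abs) simp
  qed
  show ?thesis
    unfolding sph_harm_nonneg_def coeff_null_quadric_power[OF assms(1)] of_real_mult P S[symmetric]
    by (simp add: mult_ac)
qed

text \<open>For \<open>k \<le> N\<close> the square times \<open>N choose k\<close> is
  \<open>fact N\<close>. Rescaling by this weight absorbs the binomial factors that keep the
  substitution matrices from being unitary.\<close>

definition harm_weight :: "nat \<Rightarrow> nat \<Rightarrow> real" where
  "harm_weight N k = sqrt (fact k * fact (N - k))"

definition harm_const :: "nat \<Rightarrow> real" where
  "harm_const l = sqrt (2 * real l + 1) / (2 ^ l * fact l)"

text \<open>For negative orders, reversing the coefficients of the quadric power produces exactly
  the conjugate and the sign in the definition of \<open>sph_harm\<close>, so the single position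
  \<open>l + n\<close> serves all orders.\<close>

lemma sph_harm_coeff:
  assumes "x \<in> S2" "n \<in> idx l"
  shows "sph_harm l n x = of_real (harm_const l * harm_weight (2 * l) (nat (int l + n)))
           * coeff (null_quadric x ^ l) (nat (int l + n))"
proof (cases "0 \<le> n")
  case True
  then obtain m where m: "n = int m"
    by (metis nonneg_int_cases)
  then have "m \<le> l" "nat (int l + n) = l + m"
    using assms(2) by (auto simp: idx_def)
  moreover have "2 * l - (l + m) = l - m"
    using \<open>m \<le> l\<close> by simp
  ultimately show ?thesis
    using assms(1) m
    by (simp add: sph_harm_def sph_harm_nonneg_coeff harm_const_def harm_weight_def mult.commute
        real_sqrt_mult)
next
  case False
  then obtain m where m: "n = - int m"
    by (metis nonpos_int_cases linorder_not_le order.strict_implies_order)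
  then have ml: "m \<le> l" "nat (int l + n) = l - m"
    using assms(2) by (auto simp: idx_def)
  let ?w = "plane x" and ?z = "of_real (2 * x $ 3) :: complex"
  have "coeff (null_quadric x ^ l) (l - m) = coeff ([:cnj ?w, ?z, - ?w:] ^ l) (2 * l - (l + m))"
    using ml by (simp add: null_quadric_def)
  also have "\<dots> = coeff ([:- ?w, ?z, cnj ?w:] ^ l) (l + m)"
    using ml by (intro coeff_quadratic_power_reverse) simp
  \<comment> \<open>Replacing \<open>t\<close> by \<open>- t\<close> and extracting
    \<open>- 1\<close> turns the reversed quadric into the conjugate one; the signs collected are
    \<open>(- 1) ^ l\<close> and \<open>(- 1) ^ (l + m)\<close>.\<close>
  also have "[:- ?w, ?z, cnj ?w:] = [:-1:] * ([:?w, ?z, - cnj ?w:] \<circ>\<^sub>p [:0, -1:])"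
    by (simp add: pcompose_pCons)
  also have "\<dots> ^ l = smult ((-1) ^ l) (([:?w, ?z, - cnj ?w:] ^ l) \<circ>\<^sub>p [:0, -1:])"
    unfolding power_mult_distrib by (simp add: poly_const_pow pcompose_power)
  also have "coeff \<dots> (l + m) = (-1) ^ l * (-1) ^ (l + m) * coeff ([:?w, ?z, - cnj ?w:] ^ l) (l + m)"
    by (simp add: coeff_pcompose_linear) (simp add: coeff_eq_higher_pderiv)
  also have "(-1) ^ l * (-1) ^ (l + m) = ((-1) ^ m :: complex)"
    by (simp add: power_add flip: mult.assoc power_mult_distrib)
  also have "[:?w, ?z, - cnj ?w:] ^ l = map_poly cnj (null_quadric x ^ l)"
  proof (induction l)
    case (Suc l)
    have "map_poly cnj (p * q) = map_poly cnj p * map_poly cnj q" for p q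
      by (intro poly_eqI) (simp add: coeff_map_poly coeff_mult)
    with Suc show ?case
      by (simp add: null_quadric_def map_poly_pCons del: mult_pCons_left)
  qed (simp add: map_poly_1')
  finally have c: "coeff (null_quadric x ^ l) (l - m)
      = (-1) ^ m * cnj (coeff (null_quadric x ^ l) (l + m))"
    by (simp add: coeff_map_poly)
  have "2 * l - (l - m) = l + m"
    using ml by simp
  then show ?thesis
    using assms(1) m ml False c
    by (simp add: sph_harm_def sph_harm_nonneg_coeff harm_const_def harm_weight_def mult.commute
        real_sqrt_mult)
qed

text \<open>The quadric is odd in \<open>x\<close>, so its \<open>l\<close>-th power has the parity
  of \<open>l\<close>.\<close>

lemma sph_harm_uminus:
  assumes "x \<in> S2" "n \<in> idx l"
  shows "sph_harm l n (- x) = (- 1) ^ l * sph_harm l n x"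
proof -
  have "null_quadric (- x) = smult (- 1) (null_quadric x)"
    by (simp add: null_quadric_def complex_eq_iff)
  then have "null_quadric (- x) ^ l = smult ((- 1) ^ l) (null_quadric x ^ l)"
    by (simp only: smult_power)
  with assms show ?thesis
    by (simp add: sph_harm_coeff)
qed

section \<open>Rotations about the third and the second axis\<close>

definition rot_z :: "real \<Rightarrow> real^3^3" where
  "rot_z \<phi> = vector [vector [cos \<phi>, - sin \<phi>, 0], vector [sin \<phi>, cos \<phi>, 0], vector [0, 0, 1]]"

definition rot_y :: "real \<Rightarrow> real^3^3" where
  "rot_y \<beta> = vector [vector [cos \<beta>, 0, sin \<beta>], vector [0, 1, 0], vector [- sin \<beta>, 0, cos \<beta>]]"

lemma rot_z_mult_nth [simp]:
  "(rot_z \<phi> *v x) $ 1 = cos \<phi> * x $ 1 - sin \<phi> * x $ 2"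
  "(rot_z \<phi> *v x) $ 2 = sin \<phi> * x $ 1 + cos \<phi> * x $ 2"
  "(rot_z \<phi> *v x) $ 3 = x $ 3"
  by (simp_all add: rot_z_def matrix_vector_mult_def sum_3)

lemma rot_y_mult_nth [simp]:
  "(rot_y \<beta> *v x) $ 1 = cos \<beta> * x $ 1 + sin \<beta> * x $ 3"
  "(rot_y \<beta> *v x) $ 2 = x $ 2"
  "(rot_y \<beta> *v x) $ 3 = cos \<beta> * x $ 3 - sin \<beta> * x $ 1"
  by (simp_all add: rot_y_def matrix_vector_mult_def sum_3)

lemma rot_z_S2: "x \<in> S2 \<Longrightarrow> rot_z \<phi> *v x \<in> S2"
proof -
  assume "x \<in> S2"
  have "(c * a - s * b)\<^sup>2 + (s * a + c * b)\<^sup>2 = (s\<^sup>2 + c\<^sup>2) * (a\<^sup>2 + b\<^sup>2)" for a b c s :: real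
    by algebra
  then show ?thesis
    using \<open>x \<in> S2\<close> by (simp only: S2_iff rot_z_mult_nth sin_cos_squared_add mult_1)
qed

lemma sph_harm_rot_z: "sph_harm l n (rot_z \<phi> *v x) = cis (of_int n * \<phi>) * sph_harm l n x"
proof -
  have "plane (rot_z \<phi> *v x) = cis \<phi> * plane x"
    by (simp add: complex_eq_iff)
  then have *: "sph_harm_nonneg l m (rot_z \<phi> *v x) = cis (real m * \<phi>) * sph_harm_nonneg l m x" for m
    by (simp add: sph_harm_nonneg_def power_mult_distrib Complex.DeMoivre)
  show ?thesis
    by (cases "0 \<le> n") (simp_all add: sph_harm_def * cis_cnj)
qed

section \<open>Linear independence of the spherical harmonics\<close>

lemma infinite_range_cis: "infinite (range cis)"
proof
  assume "finite (range cis)"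
  then have "finite (Re ` range cis)"
    by (rule finite_imageI)
  moreover have "{-1..1} \<subseteq> Re ` range cis"
    by (auto simp: image_image intro!: image_eqI[where f = cos, OF cos_arccos[symmetric]])
  ultimately have "finite {-1..1 :: real}"
    by (rule rev_finite_subset)
  then show False
    by (simp add: infinite_Icc)
qed

text \<open>Multiplication by \<open>cis (L * \<phi>)\<close> turns the trigonometric sum into an
  ordinary polynomial in \<open>cis \<phi>\<close>, which has infinitely many zeros.\<close>

lemma fourier_unique:
  assumes "\<And>\<phi>. (\<Sum>m\<in>idx L. b m * cis (of_int m * \<phi>)) = 0" and m: "m \<in> idx L"
  shows "b m = 0"
proof -
  define p where "p = (\<Sum>m\<in>idx L. monom (b m) (nat (int L + m)))"
  have "poly p (cis \<phi>) = 0" for \<phi>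
  proof -
    have "cis \<phi> ^ nat (int L + k) = cis (real L * \<phi>) * cis (of_int k * \<phi>)" if "k \<in> idx L" for k
      using that by (simp add: idx_def Complex.DeMoivre cis_mult algebra_simps)
    then have "poly p (cis \<phi>) = cis (real L * \<phi>) * (\<Sum>m\<in>idx L. b m * cis (of_int m * \<phi>))"
      by (simp add: p_def poly_sum poly_monom sum_distrib_left mult_ac)
    then show ?thesis
      using assms by simp
  qed
  then have "range cis \<subseteq> {z. poly p z = 0}"
    by auto
  then have "p = 0"
    using poly_roots_finite infinite_range_cis finite_subset by blast
  then have "0 = coeff p (nat (int L + m))"
    by simp
  also have "\<dots> = (\<Sum>k\<in>idx L. if k = m then b k else 0)"
    unfolding p_def coeff_sum using m by (intro sum.cong) (auto simp: idx_def)
  also have "\<dots> = b m"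
    using m by (simp add: idx_def)
  finally show ?thesis by simp
qed

text \<open>Among the indices with nonzero coefficient, the one of largest degree alone contributes
  to the coefficient at that degree.\<close>

lemma distinct_degree_independent:
  fixes p :: "'j \<Rightarrow> 'a::idom poly"
  assumes "finite A" and inj: "inj_on (\<lambda>j. degree (p j)) A" and nz: "\<And>j. j \<in> A \<Longrightarrow> p j \<noteq> 0"
    and sum: "(\<Sum>j\<in>A. smult (d j) (p j)) = 0" and "j \<in> A"
  shows "d j = 0"
proof (rule ccontr)
  assume "d j \<noteq> 0"
  define B where "B = {j \<in> A. d j \<noteq> 0}"
  have B: "finite B" "B \<noteq> {}"
    using \<open>finite A\<close> \<open>j \<in> A\<close> \<open>d j \<noteq> 0\<close> by (auto simp: B_def)
  then have "Max ((\<lambda>j. degree (p j)) ` B) \<in> (\<lambda>j. degree (p j)) ` B"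
    by (intro Max_in) auto
  then obtain k where k: "k \<in> B" "degree (p k) = Max ((\<lambda>j. degree (p j)) ` B)"
    by auto
  have "d i * coeff (p i) (degree (p k)) = 0" if "i \<in> A" "i \<noteq> k" for i
  proof (cases "i \<in> B")
    case True
    then have "degree (p i) \<le> degree (p k)"
      using k B by simp
    moreover have "degree (p i) \<noteq> degree (p k)"
      using inj that k by (auto simp: B_def inj_on_def)
    ultimately show ?thesis
      by (simp add: coeff_eq_0)
  qed (use that in \<open>simp add: B_def\<close>)
  then have "(\<Sum>i\<in>A. d i * coeff (p i) (degree (p k)))
      = (\<Sum>i\<in>A. if i = k then d k * lead_coeff (p k) else 0)"
    by (intro sum.cong) auto
  also have "\<dots> = d k * lead_coeff (p k)"
    using k \<open>finite A\<close> by (simp add: B_def)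
  also have "(\<Sum>i\<in>A. d i * coeff (p i) (degree (p k))) = coeff (\<Sum>j\<in>A. smult (d j) (p j)) (degree (p k))"
    by (simp add: coeff_sum)
  finally have "lead_coeff (p k) = 0"
    using k(1) by (simp add: sum B_def del: leading_coeff_0_iff)
  then show False
    using k(1) nz by (simp add: B_def)
qed

lemma higher_pderiv_legendre:
  assumes "m \<le> l"
  shows "degree ((pderiv ^^ m) (legendre l)) = l - m" and "(pderiv ^^ m) (legendre l) \<noteq> 0"
proof -
  have deg: "degree ([:- 1, 0, 1:] ^ l :: real poly) = 2 * l"
    by (simp add: degree_power_eq)
  have "lead_coeff ([:- 1, 0, 1:] ^ l :: real poly) = 1"
    by (simp add: lead_coeff_power)
  then have "coeff (legendre l) l \<noteq> 0"
    by (simp add: legendre_def coeff_higher_pderiv deg mult_2 pochhammer_eq_0_iff)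
  then have "coeff ((pderiv ^^ m) (legendre l)) (l - m) \<noteq> 0"
    using assms by (simp add: coeff_higher_pderiv pochhammer_eq_0_iff)
  then show "(pderiv ^^ m) (legendre l) \<noteq> 0"
    by auto
  show "degree ((pderiv ^^ m) (legendre l)) = l - m"
    by (simp add: legendre_def degree_higher_pderiv deg)
qed

text \<open>Rotating about the third axis and comparing Fourier modes isolates the order
  \<open>m\<close>. Along a meridian the harmonics of this order are, up to a common nonzero factor,
  multiples of derivatives of Legendre polynomials, whose degrees are distinct.\<close>

lemma sph_harm_independent:
  assumes zero: "\<And>x. x \<in> S2 \<Longrightarrow> (\<Sum>j\<le>L. \<Sum>m\<in>idx j. a j m * sph_harm j m x) = 0"
    and "j \<le> L" and m: "m \<in> idx j"
  shows "a j m = 0"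
proof -
  define M where "M = nat \<bar>m\<bar>"
  have Mj: "M \<le> j" and mL: "m \<in> idx L"
    using m \<open>j \<le> L\<close> by (auto simp: M_def idx_def)
  have idx_iff: "k \<in> idx i \<longleftrightarrow> nat \<bar>k\<bar> \<le> i" for k i
    by (auto simp: idx_def)
  have fourier: "(\<Sum>i\<in>{M..L}. a i m * sph_harm i m x) = 0" if "x \<in> S2" for x
  proof -
    have "(\<Sum>k\<in>idx L. (\<Sum>i\<in>{i\<in>{..L}. k \<in> idx i}. a i k * sph_harm i k x) * cis (of_int k * \<phi>)) = 0" for \<phi>
    proof -
      have x: "rot_z \<phi> *v x \<in> S2"
        by (rule rot_z_S2[OF that])
      have "{k \<in> idx L. k \<in> idx i} = idx i" if "i \<le> L" for i
        using that by (auto simp: idx_def)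
      then have "(\<Sum>i\<le>L. \<Sum>k\<in>idx i. a i k * sph_harm i k (rot_z \<phi> *v x))
          = (\<Sum>i\<le>L. \<Sum>k\<in>{k \<in> idx L. k \<in> idx i}. a i k * sph_harm i k x * cis (of_int k * \<phi>))"
        by (intro sum.cong) (simp_all add: sph_harm_rot_z mult_ac)
      also have "\<dots> = (\<Sum>k\<in>idx L. \<Sum>i\<in>{i\<in>{..L}. k \<in> idx i}. a i k * sph_harm i k x * cis (of_int k * \<phi>))"
        by (intro sum.swap_restrict) (simp_all add: idx_def)
      finally show ?thesis
        using zero[OF x] by (simp add: sum_distrib_right)
    qed
    from fourier_unique[OF this mL] have "(\<Sum>i\<in>{i\<in>{..L}. m \<in> idx i}. a i m * sph_harm i m x) = 0" .
    also have "{i\<in>{..L}. m \<in> idx i} = {M..L}"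
      by (auto simp: idx_iff M_def)
    finally show ?thesis .
  qed
  define c where "c i = sqrt ((2 * real i + 1) * fact (i - M) / fact (i + M))" for i
  define p where "p i = map_poly (of_real :: real \<Rightarrow> complex) ((pderiv ^^ M) (legendre i))" for i
  have "poly (\<Sum>i\<in>{M..L}. smult (a i m * of_real (c i)) (p i)) (of_real z) = 0"
    if z: "z \<in> {-1<..<1}" for z
  proof -
    define r where "r = sqrt (1 - z\<^sup>2)"
    have "z\<^sup>2 < 1"
      using z by (simp add: abs_square_less_1 abs_less_iff)
    then have r: "r > 0" "r\<^sup>2 = 1 - z\<^sup>2"
      by (simp_all add: r_def)
    \<comment> \<open>The point of height \<open>z\<close> on the meridian where
      \<open>plane x\<close> is a positive real number; the poles are excluded so that
      \<open>r ^ M\<close> is nonzero.\<close>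
    define x :: "real^3" where "x = vector [r, 0, z]"
    have x: "x \<in> S2"
      unfolding S2_iff using r by (simp add: x_def)
    have plane: "plane x = of_real r"
      by (simp add: x_def complex_eq_iff)
    \<comment> \<open>The factor shared by all degrees \<open>i\<close>. For negative
      \<open>m\<close> the sign in \<open>sph_harm\<close> cancels the Condon-Shortley sign.\<close>
    define s :: complex where "s = (if 0 \<le> m then (-1) ^ M else 1) * of_real (r ^ M)"
    have "s \<noteq> 0"
      using r by (simp add: s_def)
    have "sph_harm i m x = s * (of_real (c i) * poly (p i) (of_real z))" if "i \<in> {M..L}" for i
    proof -
      have "sph_harm_nonneg i M x = (-1) ^ M * (of_real (c i) * poly (p i) (of_real z)) * of_real (r ^ M)"
        unfolding sph_harm_nonneg_def plane p_def poly_map_poly_of_real c_def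
        by (simp add: x_def)
      moreover have "cnj (poly (p i) (of_real z)) = poly (p i) (of_real z)"
        by (simp add: p_def poly_map_poly_of_real)
      moreover have "0 \<le> m \<Longrightarrow> nat m = M" "\<not> 0 \<le> m \<Longrightarrow> nat (- m) = M"
        by (auto simp: M_def)
      moreover have "(-1) ^ M * ((-1) ^ M * y) = y" for y :: complex
        by (simp flip: mult.assoc power_mult_distrib)
      ultimately show ?thesis
        by (cases "0 \<le> m") (simp_all add: sph_harm_def s_def mult_ac)
    qed
    then have "(\<Sum>i\<in>{M..L}. a i m * sph_harm i m x)
        = s * (\<Sum>i\<in>{M..L}. a i m * of_real (c i) * poly (p i) (of_real z))"
      by (simp add: sum_distrib_left mult_ac)
    with fourier[OF x] \<open>s \<noteq> 0\<close> show ?thesis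
      by (simp add: poly_sum)
  qed
  then have "of_real ` {-1<..<1} \<subseteq> {z. poly (\<Sum>i\<in>{M..L}. smult (a i m * of_real (c i)) (p i)) z = 0}"
    by auto
  moreover have "infinite (complex_of_real ` {-1<..<1})"
    by (simp add: finite_image_iff inj_on_def)
  ultimately have "(\<Sum>i\<in>{M..L}. smult (a i m * of_real (c i)) (p i)) = 0"
    using poly_roots_finite finite_subset by blast
  moreover have "degree (p i) = i - M" "p i \<noteq> 0" if "i \<in> {M..L}" for i
    using higher_pderiv_legendre[of M i] that
    by (auto simp: p_def degree_map_poly poly_eq_iff coeff_map_poly)
  then have "inj_on (\<lambda>i. degree (p i)) {M..L}" "\<And>i. i \<in> {M..L} \<Longrightarrow> p i \<noteq> 0"
    by (auto simp: inj_on_def)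
  ultimately have "a j m * of_real (c j) = 0"
    using distinct_degree_independent[of "{M..L}" p "\<lambda>i. a i m * of_real (c i)" j] Mj \<open>j \<le> L\<close> by simp
  moreover have "c j \<noteq> 0"
    by (simp add: c_def)
  ultimately show ?thesis
    by simp
qed

section \<open>The rotation group\<close>

lemma matrix_inv_orthogonal:
  fixes g :: "real^'n^'n"
  assumes "orthogonal_matrix g"
  shows "matrix_inv g = transpose g"
proof -
  have g: "transpose g ** g = mat 1" "g ** transpose g = mat 1"
    using assms by (auto simp: orthogonal_matrix_def)
  then have "\<exists>B. g ** B = mat 1 \<and> B ** g = mat 1"
    by blast
  then have "g ** matrix_inv g = mat 1"
    unfolding matrix_inv_def by (rule someI2_ex) simp
  then have "transpose g ** (g ** matrix_inv g) = transpose g"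
    by simp
  then show ?thesis
    by (simp add: matrix_mul_assoc g)
qed

lemma SO3_D: "g \<in> SO3 \<Longrightarrow> orthogonal_matrix g" "g \<in> SO3 \<Longrightarrow> det g = 1"
  by (auto simp: SO3_def rotation_matrix_def)

lemma SO3_transpose_mult:
  assumes "g \<in> SO3"
  shows "transpose g ** g = mat 1" "g ** transpose g = mat 1"
  using SO3_D(1)[OF assms] by (auto simp: orthogonal_matrix_def)

lemma SO3_transpose: "g \<in> SO3 \<Longrightarrow> transpose g \<in> SO3"
  by (simp add: SO3_def rotation_matrix_def)

lemma SO3_mult: "g \<in> SO3 \<Longrightarrow> h \<in> SO3 \<Longrightarrow> g ** h \<in> SO3"
  by (simp add: SO3_def rotation_matrix_def orthogonal_matrix_mul det_mul)

lemma mat_1_SO3: "mat 1 \<in> SO3"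
  by (simp add: SO3_def rotation_matrix_def orthogonal_matrix_id)

lemma orthogonal_matrix_S2: "orthogonal_matrix g \<Longrightarrow> x \<in> S2 \<Longrightarrow> g *v x \<in> S2"
  using orthogonal_transformation_norm[of "(*v) g" x] orthogonal_transformation_matrix[of "(*v) g"]
  by simp

lemma SO3_S2: "g \<in> SO3 \<Longrightarrow> x \<in> S2 \<Longrightarrow> g *v x \<in> S2"
  by (rule orthogonal_matrix_S2[OF SO3_D(1)])

lemma transpose_rot_z: "transpose (rot_z \<phi>) = rot_z (- \<phi>)"
  by (simp add: rot_z_def transpose_def vec_eq_iff forall_3)

lemma transpose_rot_y: "transpose (rot_y \<beta>) = rot_y (- \<beta>)"
  by (simp add: rot_y_def transpose_def vec_eq_iff forall_3)

lemma sin_cos_one: "sin t * sin t + cos t * cos t = (1 :: real)" "cos t * cos t + sin t * sin t = (1 :: real)"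
  by (simp_all flip: power2_eq_square)

lemma rot_z_SO3: "rot_z \<phi> \<in> SO3"
proof -
  have "transpose (rot_z \<phi>) ** rot_z \<phi> = mat 1"
    unfolding transpose_rot_z
    by (simp add: rot_z_def matrix_matrix_mult_def mat_def vec_eq_iff forall_3 sum_3 sin_cos_one)
  moreover have "det (rot_z \<phi>) = 1"
    by (simp add: rot_z_def det_3 sin_cos_one)
  ultimately show ?thesis
    by (simp add: SO3_def rotation_matrix_def orthogonal_matrix)
qed

lemma rot_y_SO3: "rot_y \<beta> \<in> SO3"
proof -
  have "transpose (rot_y \<beta>) ** rot_y \<beta> = mat 1"
    unfolding transpose_rot_y
    by (simp add: rot_y_def matrix_matrix_mult_def mat_def vec_eq_iff forall_3 sum_3 sin_cos_one)
  moreover have "det (rot_y \<beta>) = 1"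
    by (simp add: rot_y_def det_3 sin_cos_one)
  ultimately show ?thesis
    by (simp add: SO3_def rotation_matrix_def orthogonal_matrix)
qed

section \<open>The north pole and Euler angles\<close>

definition pole :: "real^3" where
  "pole = vector [0, 0, 1]"

lemma pole_S2: "pole \<in> S2"
  unfolding S2_iff by (simp add: pole_def)

text \<open>Spherical coordinates: \<open>\<alpha>\<close> is the azimuth and \<open>\<beta>\<close>
  the polar angle.\<close>

lemma S2_euler:
  assumes "x \<in> S2"
  obtains \<alpha> \<beta> where "x = (rot_z \<alpha> ** rot_y \<beta>) *v pole"
proof -
  have x: "(x $ 1)\<^sup>2 + (x $ 2)\<^sup>2 = 1 - (x $ 3)\<^sup>2"
    using assms[unfolded S2_iff] by simp
  moreover have "0 \<le> (x $ 1)\<^sup>2 + (x $ 2)\<^sup>2"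
    by simp
  ultimately have "(x $ 3)\<^sup>2 \<le> 1"
    by simp
  then have z: "- 1 \<le> x $ 3" "x $ 3 \<le> 1"
    by (simp_all add: abs_square_le_1 abs_le_iff)
  have "plane x = rcis (cmod (plane x)) (Arg (plane x))"
    by (simp add: rcis_cmod_Arg)
  moreover have "cmod (plane x) = sin (arccos (x $ 3))"
    using x z by (simp add: cmod_def sin_arccos)
  ultimately have "plane x = rcis (sin (arccos (x $ 3))) (Arg (plane x))"
    by simp
  then have "x $ 1 = sin (arccos (x $ 3)) * cos (Arg (plane x))"
    "x $ 2 = sin (arccos (x $ 3)) * sin (Arg (plane x))"
    by (simp_all add: complex_eq_iff)
  then have "x = (rot_z (Arg (plane x)) ** rot_y (arccos (x $ 3))) *v pole"
    using z by (simp add: vec_eq_iff forall_3 pole_def mult.commute flip: matrix_vector_mul_assoc)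
  then show ?thesis
    using that by blast
qed

text \<open>The third column is the pole, orthogonality makes the third row the same, and the
  remaining block is a rotation of the plane.\<close>

lemma SO3_fixing_pole:
  assumes "h \<in> SO3" "h *v pole = pole"
  obtains \<gamma> where "h = rot_z \<gamma>"
proof -
  have col: "h $ 1 $ 3 = 0" "h $ 2 $ 3 = 0" "h $ 3 $ 3 = 1"
    using assms(2) by (simp_all add: pole_def matrix_vector_mult_def vec_eq_iff forall_3 sum_3)
  have "(h ** transpose h) $ 3 $ 3 = 1"
    by (simp add: SO3_transpose_mult[OF assms(1)] mat_def)
  then have "(h $ 3 $ 1)\<^sup>2 + (h $ 3 $ 2)\<^sup>2 = 0"
    using col by (simp add: matrix_matrix_mult_def transpose_def sum_3 power2_eq_square)
  then have row: "h $ 3 $ 1 = 0" "h $ 3 $ 2 = 0"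
    by (simp_all add: sum_power2_eq_zero_iff)
  have "(transpose h ** h) $ 1 $ 1 = 1" "(transpose h ** h) $ 2 $ 2 = 1"
    by (simp_all add: SO3_transpose_mult[OF assms(1)] mat_def)
  then have norms: "(h $ 1 $ 1)\<^sup>2 + (h $ 2 $ 1)\<^sup>2 = 1" "(h $ 1 $ 2)\<^sup>2 + (h $ 2 $ 2)\<^sup>2 = 1"
    using row by (simp_all add: matrix_matrix_mult_def transpose_def sum_3 power2_eq_square)
  have "h $ 1 $ 1 * h $ 2 $ 2 - h $ 1 $ 2 * h $ 2 $ 1 = 1"
    using SO3_D(2)[OF assms(1)] col row by (simp add: det_3)
  \<comment> \<open>The sum of squares is the two column norms minus twice the determinant, that is
    \<open>1 + 1 - 2\<close>.\<close>
  then have "(h $ 1 $ 1 - h $ 2 $ 2)\<^sup>2 + (h $ 1 $ 2 + h $ 2 $ 1)\<^sup>2 = 0"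
    using norms by (simp add: power2_eq_square algebra_simps)
  then have "h $ 2 $ 2 = h $ 1 $ 1" "h $ 1 $ 2 = - h $ 2 $ 1"
    by (simp_all add: sum_power2_eq_zero_iff)
  moreover obtain \<gamma> where "h $ 1 $ 1 = cos \<gamma>" "h $ 2 $ 1 = sin \<gamma>"
    using sincos_total_2pi[OF norms(1)] by metis
  ultimately have "h = rot_z \<gamma>"
    using col row by (simp add: rot_z_def vec_eq_iff forall_3)
  then show ?thesis
    using that by blast
qed

text \<open>A product \<open>r\<close> of two axis rotations sends the pole to the same point as
  \<open>g\<close>, so \<open>r\<close> and \<open>g\<close> differ by a rotation fixing the
  pole.\<close>

lemma SO3_euler:
  assumes "g \<in> SO3"
  obtains \<alpha> \<beta> \<gamma> where "g = rot_z \<alpha> ** rot_y \<beta> ** rot_z \<gamma>"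
proof -
  obtain \<alpha> \<beta> where ab: "g *v pole = (rot_z \<alpha> ** rot_y \<beta>) *v pole"
    using S2_euler[OF SO3_S2[OF assms pole_S2]] by metis
  define r where "r = rot_z \<alpha> ** rot_y \<beta>"
  have r: "r \<in> SO3"
    unfolding r_def by (intro SO3_mult rot_z_SO3 rot_y_SO3)
  have "(transpose r ** g) *v pole = pole"
  proof -
    have "transpose r *v (g *v pole) = transpose r *v (r *v pole)"
      by (simp only: ab r_def)
    then show ?thesis
      by (simp add: matrix_vector_mul_assoc SO3_transpose_mult[OF r])
  qed
  then obtain \<gamma> where "transpose r ** g = rot_z \<gamma>"
    using SO3_fixing_pole SO3_mult[OF SO3_transpose[OF r] assms] by metis
  then have "r ** (transpose r ** g) = r ** rot_z \<gamma>"
    by simp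
  then have "g = r ** rot_z \<gamma>"
    by (simp add: matrix_mul_assoc SO3_transpose_mult[OF r])
  then show ?thesis
    using that by (simp add: r_def)
qed

section \<open>Existence and unitarity of the Wigner matrices\<close>

text \<open>The property in the description that defines \<open>wigner_D\<close>, with the inverse
  replaced by the transpose; vanishing outside \<open>idx l\<close> makes the matrix unique as a
  function.\<close>

definition is_wigner :: "nat \<Rightarrow> real^3^3 \<Rightarrow> (int \<Rightarrow> int \<Rightarrow> complex) \<Rightarrow> bool" where
  "is_wigner l g D \<longleftrightarrow>
     (\<forall>n' n. n' \<notin> idx l \<or> n \<notin> idx l \<longrightarrow> D n' n = 0) \<and>
     (\<forall>n\<in>idx l. \<forall>x\<in>S2.
        sph_harm l n (transpose g *v x) = (\<Sum>n'\<in>idx l. D n' n * sph_harm l n' x))"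

definition adjoint_matrix :: "(int \<Rightarrow> int \<Rightarrow> complex) \<Rightarrow> int \<Rightarrow> int \<Rightarrow> complex" where
  "adjoint_matrix D = (\<lambda>n' n. cnj (D n n'))"

lemma is_wigner_unique:
  assumes "is_wigner l g D" "is_wigner l g E"
  shows "D = E"
proof (intro ext)
  fix n' n
  show "D n' n = E n' n"
  proof (cases "n' \<in> idx l \<and> n \<in> idx l")
    case True
    \<comment> \<open>The coefficients are padded by zero in the degrees below \<open>l\<close>, to
      match the double sum in \<open>sph_harm_independent\<close>.\<close>
    let ?a = "\<lambda>j m. if j = l then D m n - E m n else 0"
    have "(\<Sum>j\<le>l. \<Sum>m\<in>idx j. ?a j m * sph_harm j m x) = 0" if "x \<in> S2" for x
    proof -
      have "(\<Sum>j\<le>l. \<Sum>m\<in>idx j. ?a j m * sph_harm j m x)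
          = (\<Sum>j\<le>l. if j = l then \<Sum>m\<in>idx l. (D m n - E m n) * sph_harm l m x else 0)"
        by (intro sum.cong) auto
      also have "\<dots> = (\<Sum>m\<in>idx l. D m n * sph_harm l m x) - (\<Sum>m\<in>idx l. E m n * sph_harm l m x)"
        by (simp add: left_diff_distrib sum_subtractf)
      also have "\<dots> = 0"
      proof -
        have "(\<Sum>m\<in>idx l. F m n * sph_harm l m x) = sph_harm l n (transpose g *v x)"
          if "is_wigner l g F" for F
          using that True \<open>x \<in> S2\<close> by (simp add: is_wigner_def)
        then show ?thesis
          using assms by simp
      qed
      finally show ?thesis .
    qed
    from sph_harm_independent[OF this, of l n'] True show ?thesis
      by simp
  next
    case False
    then have "D n' n = 0 \<and> E n' n = 0"
      using assms unfolding is_wigner_def by blast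
    then show ?thesis by simp
  qed
qed

lemma wigner_D_eqI:
  assumes "g \<in> SO3" "is_wigner l g D"
  shows "wigner_D l g = D"
proof -
  have "wigner_D l g = (THE D. is_wigner l g D)"
    unfolding wigner_D_def is_wigner_def matrix_inv_orthogonal[OF SO3_D(1)[OF assms(1)]] ..
  then show ?thesis
    using assms is_wigner_unique by (simp add: the_equality)
qed

text \<open>The inverse of \<open>g ** h\<close> applies the inverse of \<open>g\<close> first,
  which keeps the order of the factors in the matrix product.\<close>

lemma is_wigner_mult:
  assumes "g \<in> SO3" "is_wigner l g D" "is_wigner l h E"
  shows "is_wigner l (g ** h) (\<lambda>n' n. \<Sum>k\<in>idx l. D n' k * E k n)"
  unfolding is_wigner_def
proof (intro conjI allI impI ballI)
  fix n' n assume "n' \<notin> idx l \<or> n \<notin> idx l"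
  then have "D n' k * E k n = 0" for k
    using assms(2,3) by (auto simp: is_wigner_def)
  then show "(\<Sum>k\<in>idx l. D n' k * E k n) = 0"
    by (intro sum.neutral ballI)
next
  fix n and x :: "real^3" assume n: "n \<in> idx l" and x: "x \<in> S2"
  have gx: "transpose g *v x \<in> S2"
    using assms(1) x by (intro SO3_S2 SO3_transpose)
  have "sph_harm l n (transpose (g ** h) *v x) = sph_harm l n (transpose h *v (transpose g *v x))"
    by (simp only: matrix_transpose_mul matrix_vector_mul_assoc)
  also have "\<dots> = (\<Sum>k\<in>idx l. E k n * sph_harm l k (transpose g *v x))"
    using assms(3) n gx by (simp add: is_wigner_def)
  also have "\<dots> = (\<Sum>k\<in>idx l. E k n * (\<Sum>n'\<in>idx l. D n' k * sph_harm l n' x))"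
    using assms(2) x by (intro sum.cong) (simp_all add: is_wigner_def)
  also have "\<dots> = (\<Sum>k\<in>idx l. \<Sum>n'\<in>idx l. D n' k * E k n * sph_harm l n' x)"
    by (simp add: sum_distrib_left mult_ac)
  also have "\<dots> = (\<Sum>n'\<in>idx l. (\<Sum>k\<in>idx l. D n' k * E k n) * sph_harm l n' x)"
    by (subst sum.swap) (simp add: sum_distrib_right)
  finally show "sph_harm l n (transpose (g ** h) *v x)
      = (\<Sum>n'\<in>idx l. (\<Sum>k\<in>idx l. D n' k * E k n) * sph_harm l n' x)" .
qed

text \<open>Unitarity without integration over the sphere: the adjoint of a Wigner matrix of
  \<open>g\<close> is a Wigner matrix of the inverse. In this form it passes to products, so
  checking it on generators suffices.\<close>

definition unitary_wigner :: "nat \<Rightarrow> real^3^3 \<Rightarrow> bool" where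
  "unitary_wigner l g \<longleftrightarrow>
     g \<in> SO3 \<and> (\<exists>D. is_wigner l g D \<and> is_wigner l (transpose g) (adjoint_matrix D))"

lemma unitary_wigner_mult:
  assumes "unitary_wigner l g" "unitary_wigner l h"
  shows "unitary_wigner l (g ** h)"
proof -
  obtain D E where D: "is_wigner l g D" "is_wigner l (transpose g) (adjoint_matrix D)"
    and E: "is_wigner l h E" "is_wigner l (transpose h) (adjoint_matrix E)"
    and g: "g \<in> SO3" "h \<in> SO3"
    using assms unfolding unitary_wigner_def by blast
  have "is_wigner l (transpose (g ** h))
      (\<lambda>n' n. \<Sum>k\<in>idx l. adjoint_matrix E n' k * adjoint_matrix D k n)"
    using is_wigner_mult[OF SO3_transpose[OF g(2)] E(2) D(2)] by (simp add: matrix_transpose_mul)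
  also have "(\<lambda>n' n. \<Sum>k\<in>idx l. adjoint_matrix E n' k * adjoint_matrix D k n)
      = adjoint_matrix (\<lambda>n' n. \<Sum>k\<in>idx l. D n' k * E k n)"
    by (simp add: adjoint_matrix_def mult.commute)
  finally show ?thesis
    unfolding unitary_wigner_def using is_wigner_mult[OF g(1) D(1) E(1)] SO3_mult[OF g] by blast
qed

section \<open>Wigner matrices of the rotations about the two axes\<close>

lemma is_wigner_rot_z:
  "is_wigner l (rot_z \<phi>) (\<lambda>n' n. if n' = n \<and> n \<in> idx l then cis (- (of_int n * \<phi>)) else 0)"
proof -
  have "(\<Sum>n'\<in>idx l. (if n' = n \<and> n \<in> idx l then cis (- (of_int n * \<phi>)) else 0) * sph_harm l n' x)
      = cis (- (of_int n * \<phi>)) * sph_harm l n x" if "n \<in> idx l" for n x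
  proof -
    have "(\<Sum>n'\<in>idx l. (if n' = n \<and> n \<in> idx l then cis (- (of_int n * \<phi>)) else 0) * sph_harm l n' x)
        = (\<Sum>n'\<in>idx l. if n' = n then cis (- (of_int n * \<phi>)) * sph_harm l n x else 0)"
      using that by (intro sum.cong) auto
    then show ?thesis
      using that by (simp add: idx_def)
  qed
  then show ?thesis
    by (auto simp: is_wigner_def transpose_rot_z sph_harm_rot_z)
qed

lemma unitary_wigner_rot_z: "unitary_wigner l (rot_z \<phi>)"
proof -
  have "is_wigner l (transpose (rot_z \<phi>)) (adjoint_matrix
      (\<lambda>n' n. if n' = n \<and> n \<in> idx l then cis (- (of_int n * \<phi>)) else 0))"
  proof -
    have "(\<lambda>n' n. if n' = n \<and> n \<in> idx l then cis (- (of_int n * - \<phi>)) else 0) = adjoint_matrix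
      (\<lambda>n' n. if n' = n \<and> n \<in> idx l then cis (- (of_int n * \<phi>)) else 0)"
      by (auto simp: adjoint_matrix_def fun_eq_iff cis_cnj)
    then show ?thesis
      using is_wigner_rot_z[of l "- \<phi>"] by (simp only: transpose_rot_z)
  qed
  then show ?thesis
    unfolding unitary_wigner_def using rot_z_SO3 is_wigner_rot_z by blast
qed

text \<open>
  The substitution of the half-angle rotation into the monomial with exponents \<open>k\<close> and \<open>N - k\<close>.
  The generating function below is unchanged when its two variables are swapped and \<open>\<beta>\<close> is negated; after
  rescaling by \<open>harm_weight\<close> this symmetry becomes unitarity.
\<close>

definition binary_form_rot :: "nat \<Rightarrow> real \<Rightarrow> nat \<Rightarrow> nat \<Rightarrow> real" where
  "binary_form_rot N \<beta> k j =
     coeff ([:sin (\<beta> / 2), cos (\<beta> / 2):] ^ k * [:cos (\<beta> / 2), - sin (\<beta> / 2):] ^ (N - k)) j"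

text \<open>With \<open>u\<close> and \<open>v\<close> the two linear factors, the sum over
  \<open>k\<close> is the binomial expansion of \<open>(y * u + v) ^ N\<close>.\<close>

lemma binary_form_rot_generating:
  "(\<Sum>j\<le>N. (\<Sum>k\<le>N. real (N choose k) * binary_form_rot N \<beta> k j * y ^ k) * t ^ j)
   = (cos (\<beta> / 2) * y * t + sin (\<beta> / 2) * y - sin (\<beta> / 2) * t + cos (\<beta> / 2)) ^ N"
proof -
  let ?u = "[:sin (\<beta> / 2), cos (\<beta> / 2):]" and ?v = "[:cos (\<beta> / 2), - sin (\<beta> / 2):]"
  have poly: "(\<Sum>j\<le>N. binary_form_rot N \<beta> k j * t ^ j) = poly (?u ^ k * ?v ^ (N - k)) t" if "k \<le> N" for k
  proof -
    have "degree ?u * k \<le> 1 * k" "degree ?v * (N - k) \<le> 1 * (N - k)"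
      by (intro mult_right_mono; simp)+
    then have "degree (?u ^ k) \<le> k" "degree (?v ^ (N - k)) \<le> N - k"
      using degree_power_le[of ?u k] degree_power_le[of ?v "N - k"] by linarith+
    then have "degree (?u ^ k * ?v ^ (N - k)) \<le> N"
      using degree_mult_le[of "?u ^ k" "?v ^ (N - k)"] that by linarith
    then show ?thesis
      unfolding binary_form_rot_def poly_altdef
      by (intro sum.mono_neutral_right) (auto simp: coeff_eq_0)
  qed
  have "(\<Sum>j\<le>N. (\<Sum>k\<le>N. real (N choose k) * binary_form_rot N \<beta> k j * y ^ k) * t ^ j)
      = (\<Sum>k\<le>N. real (N choose k) * y ^ k * (\<Sum>j\<le>N. binary_form_rot N \<beta> k j * t ^ j))"
    unfolding sum_distrib_left sum_distrib_right by (subst sum.swap) (simp add: mult_ac)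
  also have "\<dots> = (\<Sum>k\<le>N. real (N choose k) * (y * poly ?u t) ^ k * poly ?v t ^ (N - k))"
    by (intro sum.cong) (simp_all add: poly power_mult_distrib mult.assoc)
  also have "\<dots> = (y * poly ?u t + poly ?v t) ^ N"
    by (simp add: binomial_ring)
  finally show ?thesis
    by (simp add: algebra_simps)
qed

lemma binary_form_rot_symmetric:
  assumes "j \<le> N" "k \<le> N"
  shows "real (N choose k) * binary_form_rot N \<beta> k j = real (N choose j) * binary_form_rot N (- \<beta>) j k"
proof -
  let ?A = "\<lambda>k j. real (N choose k) * binary_form_rot N \<beta> k j"
    and ?B = "\<lambda>k j. real (N choose j) * binary_form_rot N (- \<beta>) j k"
  have "(\<Sum>j\<le>N. (\<Sum>k\<le>N. ?A k j * y ^ k) * t ^ j) = (\<Sum>j\<le>N. (\<Sum>k\<le>N. ?B k j * y ^ k) * t ^ j)" for y t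
  proof -
    have "(\<Sum>j\<le>N. (\<Sum>k\<le>N. ?B k j * y ^ k) * t ^ j) = (\<Sum>k\<le>N. (\<Sum>j\<le>N. ?B k j * t ^ j) * y ^ k)"
      unfolding sum_distrib_right by (subst sum.swap) (simp add: mult_ac)
    then show ?thesis
      using binary_form_rot_generating[of N \<beta> y t] binary_form_rot_generating[of N "- \<beta>" t y]
      by (simp add: algebra_simps)
  qed
  \<comment> \<open>Coefficients are compared first in \<open>t\<close> with \<open>y\<close> fixed,
    then in \<open>y\<close>.\<close>
  then have "(\<Sum>k\<le>N. ?A k j * y ^ k) = (\<Sum>k\<le>N. ?B k j * y ^ k)" for y
    using polyfun_eq_coeffs[where n = N and c = "\<lambda>j. \<Sum>k\<le>N. ?A k j * y ^ k"
        and d = "\<lambda>j. \<Sum>k\<le>N. ?B k j * y ^ k"] assms(1) by blast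
  then show ?thesis
    using polyfun_eq_coeffs[where n = N and c = "\<lambda>k. ?A k j" and d = "\<lambda>k. ?B k j"] assms(2) by blast
qed

text \<open>The rotated quadric is the original binary form evaluated at the half-angle linear forms
  \<open>?u\<close> and \<open>?v\<close>, and homogenization commutes with taking powers.\<close>

lemma null_quadric_rot_y_power:
  "coeff (null_quadric (rot_y \<beta> *v x) ^ l) j
   = (\<Sum>k\<le>2 * l. coeff (null_quadric x ^ l) k * of_real (binary_form_rot (2 * l) \<beta> k j))"
proof -
  let ?S = "complex_of_real (sin (\<beta> / 2))" and ?C = "complex_of_real (cos (\<beta> / 2))"
  let ?u = "[:?S, ?C:]" and ?v = "[:?C, - ?S:]"
  have c: "cos \<beta> = cos (\<beta> / 2) * cos (\<beta> / 2) - sin (\<beta> / 2) * sin (\<beta> / 2)"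
    using cos_add[of "\<beta> / 2" "\<beta> / 2"] by simp
  have s: "sin \<beta> = 2 * (sin (\<beta> / 2) * cos (\<beta> / 2))"
    using sin_add[of "\<beta> / 2" "\<beta> / 2"] by simp
  \<comment> \<open>The rotation fixes the second coordinate, while the substitution multiplies it
    by the sum of the squared cosine and sine.\<close>
  have y: "x $ 2 * (cos (\<beta> / 2) * cos (\<beta> / 2)) + x $ 2 * (sin (\<beta> / 2) * sin (\<beta> / 2)) = x $ 2"
    by (simp add: sin_cos_one flip: distrib_left)
  have q: "null_quadric (rot_y \<beta> *v x)
      = smult (- plane x) (?u ^ 2) + smult (of_real (2 * x $ 3)) (?u * ?v) + smult (cnj (plane x)) (?v ^ 2)"
    using y by (simp add: null_quadric_def c s power2_eq_square complex_eq_iff algebra_simps)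
  have "null_quadric (rot_y \<beta> *v x) ^ l = homog (2 * l) (null_quadric x ^ l) ?u ?v"
    unfolding q unfolding null_quadric_def homog_quadratic_power ..
  moreover have "?u ^ k * ?v ^ (2 * l - k) = map_poly of_real
      ([:sin (\<beta> / 2), cos (\<beta> / 2):] ^ k * [:cos (\<beta> / 2), - sin (\<beta> / 2):] ^ (2 * l - k))" for k
    by (simp add: map_poly_of_real_mult map_poly_of_real_power map_poly_pCons)
  ultimately show ?thesis
    by (simp add: homog_def coeff_sum binary_form_rot_def coeff_map_poly)
qed

text \<open>The angle is negated since the inverse of the rotation acts on the argument.\<close>

definition small_d :: "nat \<Rightarrow> real \<Rightarrow> int \<Rightarrow> int \<Rightarrow> complex" where
  "small_d l \<beta> n' n = (if n' \<in> idx l \<and> n \<in> idx l then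
     (let N = 2 * l; k = nat (int l + n'); j = nat (int l + n)
      in of_real (harm_weight N j * binary_form_rot N (- \<beta>) k j / harm_weight N k)) else 0)"

lemma harm_weight_pos: "harm_weight N k > 0"
  by (simp add: harm_weight_def)

text \<open>The quotient of weights in \<open>small_d\<close> comes from passing from harmonics to
  coefficients of the quadric power and back.\<close>

lemma is_wigner_rot_y: "is_wigner l (rot_y \<beta>) (small_d l \<beta>)"
proof -
  define ix where "ix n = nat (int l + n)" for n
  have bij: "bij_betw ix (idx l) {..2 * l}"
    by (rule bij_betw_byWitness[where f' = "\<lambda>k. int k - int l"]) (auto simp: ix_def idx_def)
  have "sph_harm l n (rot_y (- \<beta>) *v x) = (\<Sum>n'\<in>idx l. small_d l \<beta> n' n * sph_harm l n' x)"
    if n: "n \<in> idx l" and x: "x \<in> S2" for n x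
  proof -
    let ?W = "harm_weight (2 * l)"
    have "sph_harm l n (rot_y (- \<beta>) *v x) = of_real (harm_const l * ?W (ix n)) *
        (\<Sum>k\<le>2 * l. coeff (null_quadric x ^ l) k * of_real (binary_form_rot (2 * l) (- \<beta>) k (ix n)))"
      using n SO3_S2[OF rot_y_SO3 x] by (simp add: sph_harm_coeff null_quadric_rot_y_power ix_def)
    also have "\<dots> = of_real (harm_const l * ?W (ix n)) *
        (\<Sum>n'\<in>idx l. coeff (null_quadric x ^ l) (ix n') * of_real (binary_form_rot (2 * l) (- \<beta>) (ix n') (ix n)))"
      by (subst sum.reindex_bij_betw[OF bij, symmetric]) simp
    also have "\<dots> = (\<Sum>n'\<in>idx l. small_d l \<beta> n' n * sph_harm l n' x)"
      unfolding sum_distrib_left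
    proof (intro sum.cong refl)
      fix n' assume "n' \<in> idx l"
      moreover have "?W (ix n') \<noteq> 0"
        using harm_weight_pos[of "2 * l" "ix n'"] by simp
      ultimately show "of_real (harm_const l * ?W (ix n)) * (coeff (null_quadric x ^ l) (ix n')
          * of_real (binary_form_rot (2 * l) (- \<beta>) (ix n') (ix n))) = small_d l \<beta> n' n * sph_harm l n' x"
        using n x by (simp add: sph_harm_coeff small_d_def Let_def flip: ix_def)
    qed
    finally show ?thesis .
  qed
  then show ?thesis
    by (auto simp: is_wigner_def transpose_rot_y small_d_def)
qed

text \<open>The entries are real, so the adjoint is the transpose, and
  \<open>binary_form_rot_symmetric\<close> relates transposed entries at opposite angles.\<close>

lemma small_d_adjoint: "adjoint_matrix (small_d l \<beta>) = small_d l (- \<beta>)"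
proof (intro ext)
  fix n' n
  show "adjoint_matrix (small_d l \<beta>) n' n = small_d l (- \<beta>) n' n"
  proof (cases "n' \<in> idx l \<and> n \<in> idx l")
    case True
    define N k j where "N = 2 * l" and "k = nat (int l + n')" and "j = nat (int l + n)"
    have kj: "k \<le> N" "j \<le> N"
      using True by (auto simp: N_def k_def j_def idx_def)
    have W: "(harm_weight N i)\<^sup>2 * real (N choose i) = fact N" if "i \<le> N" for i
      using binomial_fact_lemma[OF that]
      by (simp add: harm_weight_def) (metis of_nat_fact of_nat_mult)
    let ?V = "harm_weight N"
    have "real (N choose k) * binary_form_rot N \<beta> k j = real (N choose j) * binary_form_rot N (- \<beta>) j k"
      by (rule binary_form_rot_symmetric[OF kj(2,1)])
    \<comment> \<open>Multiplying by both squared weights lets each binomial coefficient meet its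
      own weight; both become \<open>fact N\<close> and cancel.\<close>
    then have "(?V j)\<^sup>2 * ((?V k)\<^sup>2 * real (N choose k)) * binary_form_rot N \<beta> k j
        = (?V k)\<^sup>2 * ((?V j)\<^sup>2 * real (N choose j)) * binary_form_rot N (- \<beta>) j k"
      by (simp add: mult_ac)
    then have "(?V j)\<^sup>2 * binary_form_rot N \<beta> k j = (?V k)\<^sup>2 * binary_form_rot N (- \<beta>) j k"
      unfolding W[OF kj(1)] W[OF kj(2)] by simp
    then have "?V j * binary_form_rot N \<beta> k j / ?V k = ?V k * binary_form_rot N (- \<beta>) j k / ?V j"
      using harm_weight_pos[of N k] harm_weight_pos[of N j] by (simp add: field_simps power2_eq_square)
    then show ?thesis
      using True by (simp add: adjoint_matrix_def small_d_def Let_def flip: k_def j_def N_def of_real_divide of_real_mult)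
  qed (auto simp: adjoint_matrix_def small_d_def)
qed

lemma unitary_wigner_rot_y: "unitary_wigner l (rot_y \<beta>)"
  unfolding unitary_wigner_def
  using is_wigner_rot_y[of l \<beta>] is_wigner_rot_y[of l "- \<beta>"] rot_y_SO3
  by (auto simp: transpose_rot_y simp flip: small_d_adjoint)

section \<open>Wigner matrices of arbitrary rotations\<close>

lemma SO3_unitary_wigner: "g \<in> SO3 \<Longrightarrow> unitary_wigner l g"
  by (metis SO3_euler unitary_wigner_mult unitary_wigner_rot_y unitary_wigner_rot_z)

lemma is_wigner_wigner_D: "g \<in> SO3 \<Longrightarrow> is_wigner l g (wigner_D l g)"
  using SO3_unitary_wigner[of g l] wigner_D_eqI unfolding unitary_wigner_def by metis

lemma wigner_D_outside: "g \<in> SO3 \<Longrightarrow> n' \<notin> idx l \<or> n \<notin> idx l \<Longrightarrow> wigner_D l g n' n = 0"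
  using is_wigner_wigner_D unfolding is_wigner_def by blast

text \<open>Unitarity, in the form in which the kernels use it.\<close>

lemma wigner_D_transpose:
  assumes "g \<in> SO3"
  shows "wigner_D l (transpose g) n' n = cnj (wigner_D l g n n')"
proof -
  obtain D where "is_wigner l g D" "is_wigner l (transpose g) (adjoint_matrix D)"
    using SO3_unitary_wigner[OF assms] unfolding unitary_wigner_def by blast
  then have "wigner_D l g = D" "wigner_D l (transpose g) = adjoint_matrix D"
    using assms SO3_transpose wigner_D_eqI by blast+
  then show ?thesis
    by (simp add: adjoint_matrix_def)
qed

lemma wigner_D_mult:
  assumes "g \<in> SO3" "h \<in> SO3"
  shows "wigner_D l (g ** h) n' n = (\<Sum>k\<in>idx l. wigner_D l g n' k * wigner_D l h k n)"
  using wigner_D_eqI[OF SO3_mult[OF assms] is_wigner_mult[OF assms(1)]] assms is_wigner_wigner_D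
  by metis

lemma wigner_D_rot_z:
  "wigner_D l (rot_z \<phi>) n' n = (if n' = n \<and> n \<in> idx l then cis (- (of_int n * \<phi>)) else 0)"
  by (simp only: wigner_D_eqI[OF rot_z_SO3 is_wigner_rot_z])

lemma wigner_D_id: "wigner_D l (mat 1) n' n = (if n' = n \<and> n \<in> idx l then 1 else 0)"
proof -
  have "mat 1 = rot_z 0"
    by (simp add: rot_z_def mat_def vec_eq_iff forall_3)
  then show ?thesis
    by (simp add: wigner_D_rot_z)
qed

lemma sph_harm_SO3:
  assumes "g \<in> SO3" "x \<in> S2" "n \<in> idx l"
  shows "sph_harm l n (g *v x) = (\<Sum>n'\<in>idx l. cnj (wigner_D l g n n') * sph_harm l n' x)"
  using is_wigner_wigner_D[OF SO3_transpose[OF assms(1)], of l] assms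
  by (simp add: is_wigner_def wigner_D_transpose)

section \<open>Representations and steerability\<close>

lemma std_basis_coord_space: "i \<in> I \<Longrightarrow> std_basis i \<in> coord_space I"
  by (auto simp: std_basis_def coord_space_def)

lemma Hom_coord: "f \<in> Hom I K \<Longrightarrow> v \<in> coord_space I \<Longrightarrow> f v \<in> coord_space K"
  by (simp add: Hom_def)

lemma Hom_scale: "f \<in> Hom I K \<Longrightarrow> v \<in> coord_space I \<Longrightarrow> f (\<lambda>i. c * v i) = (\<lambda>k. c * f v k)"
  by (simp add: Hom_def)

lemma Hom_add:
  assumes "f \<in> Hom I K" "v \<in> coord_space I" "w \<in> coord_space I"
  shows "f (\<lambda>i. v i + w i) = (\<lambda>k. f v k + f w k)"
  using assms by (simp add: Hom_def)

lemma Hom_sum: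
  assumes f: "f \<in> Hom I K" and "finite A" and v: "\<And>a. a \<in> A \<Longrightarrow> v a \<in> coord_space I"
  shows "f (\<lambda>i. \<Sum>a\<in>A. c a * v a i) = (\<lambda>k. \<Sum>a\<in>A. c a * f (v a) k)"
  using \<open>finite A\<close> v
proof (induction A rule: finite_induct)
  case empty
  have "(\<lambda>i. 0) \<in> coord_space I"
    by (simp add: coord_space_def)
  from Hom_scale[OF f this, of 0] show ?case by simp
next
  case (insert a A)
  have "(\<lambda>i. c a * v a i) \<in> coord_space I" "(\<lambda>i. \<Sum>a\<in>A. c a * v a i) \<in> coord_space I"
    using insert.prems by (auto simp: coord_space_def)
  from Hom_add[OF f this] have "f (\<lambda>i. c a * v a i + (\<Sum>a\<in>A. c a * v a i))
      = (\<lambda>k. f (\<lambda>i. c a * v a i) k + f (\<lambda>i. \<Sum>a\<in>A. c a * v a i) k)" .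
  moreover have "f (\<lambda>i. c a * v a i) = (\<lambda>k. c a * f (v a) k)"
    using insert.prems by (intro Hom_scale[OF f]) simp
  ultimately show ?case
    using insert by simp
qed

lemma coord_space_expansion:
  assumes "finite I" "v \<in> coord_space I"
  shows "v = (\<lambda>k. \<Sum>i\<in>I. v i * std_basis i k)"
proof
  fix k
  have "(\<Sum>i\<in>I. v i * std_basis i k) = (\<Sum>i\<in>I. if k = i then v i else 0)"
    by (intro sum.cong) (auto simp: std_basis_def)
  then show "v k = (\<Sum>i\<in>I. v i * std_basis i k)"
    using assms by (simp add: coord_space_def)
qed

lemma Hom_expansion:
  assumes "f \<in> Hom I K" "finite I" "v \<in> coord_space I"
  shows "f v k = (\<Sum>i\<in>I. v i * f (std_basis i) k)"
proof -
  have "f (\<lambda>k. \<Sum>i\<in>I. v i * std_basis i k) = (\<lambda>k. \<Sum>i\<in>I. v i * f (std_basis i) k)"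
    using assms by (intro Hom_sum std_basis_coord_space)
  then show ?thesis
    using coord_space_expansion[OF assms(2,3)] by simp
qed

lemma Hom_outside: "f \<in> Hom I K \<Longrightarrow> v \<notin> coord_space I \<Longrightarrow> f v = (\<lambda>k. 0)"
  by (simp add: Hom_def)

lemma scale_coord_space: "v \<in> coord_space I \<Longrightarrow> (\<lambda>i. c * v i) \<in> coord_space I"
  by (simp add: coord_space_def)

lemma finite_idx [simp]: "finite (idx l)"
  by (simp add: idx_def)

section \<open>The representations of the rotation group and of the orthogonal group\<close>

lemma D_map_Hom: "D_map l g \<in> Hom (idx l) (idx l)"
  by (simp add: D_map_def lin_map_in_Hom)

lemma D_map_apply:
  "g \<in> SO3 \<Longrightarrow> v \<in> coord_space (idx l) \<Longrightarrow> D_map l g v n' = (\<Sum>n\<in>idx l. wigner_D l g n' n * v n)"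
  by (simp add: D_map_def lin_map_def wigner_D_outside)

lemma D_map_mult:
  assumes "g \<in> SO3" "h \<in> SO3" "v \<in> coord_space (idx l)"
  shows "D_map l g (D_map l h v) = D_map l (g ** h) v"
proof
  fix n'
  have "D_map l g (D_map l h v) n' = (\<Sum>k\<in>idx l. \<Sum>n\<in>idx l. wigner_D l g n' k * wigner_D l h k n * v n)"
    using assms by (simp add: D_map_apply Hom_coord[OF D_map_Hom] sum_distrib_left mult.assoc)
  also have "\<dots> = D_map l (g ** h) v n'"
    using assms by (subst sum.swap) (simp add: D_map_apply SO3_mult wigner_D_mult sum_distrib_right)
  finally show "D_map l g (D_map l h v) n' = D_map l (g ** h) v n'" .
qed

lemma D_map_id:
  assumes "v \<in> coord_space (idx l)"
  shows "D_map l (mat 1) v = v"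
proof
  fix n'
  have "D_map l (mat 1) v n' = (\<Sum>n\<in>idx l. if n' = n then v n else 0)"
    using assms unfolding D_map_apply[OF mat_1_SO3 assms]
    by (intro sum.cong) (auto simp: wigner_D_id)
  then show "D_map l (mat 1) v n' = v n'"
    using assms by (simp add: coord_space_def)
qed

lemma D_map_transpose:
  assumes "g \<in> SO3" "v \<in> coord_space (idx l)"
  shows "D_map l (transpose g) (D_map l g v) = v" "D_map l g (D_map l (transpose g) v) = v"
  using assms by (simp_all add: D_map_mult SO3_transpose SO3_transpose_mult D_map_id)

text \<open>A flag selects between the two representations, so that the four cases of the theorem
  are treated at once.\<close>

definition signed_rep :: "bool \<Rightarrow> nat \<Rightarrow> real^3^3 \<Rightarrow> (int \<Rightarrow> complex) \<Rightarrow> (int \<Rightarrow> complex)" where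
  "signed_rep neg l h = (\<lambda>v n. (if neg then of_real (det h) else 1) * D_map l (det h *\<^sub>R h) v n)"

lemma signed_rep_False: "signed_rep False l = rep_plus l"
  by (simp add: signed_rep_def rep_plus_def fun_eq_iff)

lemma signed_rep_True: "signed_rep True l = rep_minus l"
  by (simp add: signed_rep_def rep_minus_def fun_eq_iff)

lemma O3_cases:
  assumes "h \<in> O3"
  obtains "det h = 1" "h \<in> SO3" | g where "det h = - 1" "g \<in> SO3" "h = - g"
proof -
  have h: "orthogonal_matrix h"
    using assms by (simp add: O3_def)
  have neg: "det (- h) = - det h"
    by (simp add: det_3)
  have "transpose (- h) = - transpose h"
    by (simp add: transpose_def vec_eq_iff)
  with h have "orthogonal_matrix (- h)"
    by (simp add: orthogonal_matrix_def matrix_matrix_mult_def vec_eq_iff)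
  then show ?thesis
    using that(1) that(2)[of "- h"] h neg det_orthogonal_matrix[OF h]
    by (auto simp: SO3_def rotation_matrix_def)
qed

text \<open>The sign is its own inverse and the transpose inverts the rotation part. This replaces
  the \<open>inv_into\<close> in \<open>steerable_kernels\<close> by an explicit map.\<close>

lemma inv_into_signed_rep:
  assumes "det h = 1 \<or> det h = - 1" "det h *\<^sub>R h \<in> SO3" "v \<in> coord_space (idx l)"
  shows "inv_into (coord_space (idx l)) (signed_rep neg l h) v
    = (\<lambda>n. (if neg then of_real (det h) else 1) * D_map l (transpose (det h *\<^sub>R h)) v n)"
proof (rule inv_into_f_eq)
  define s :: complex where "s = (if neg then of_real (det h) else 1)"
  have s: "s * (s * y) = y" for y
    using assms(1) by (auto simp: s_def)
  define g where "g = det h *\<^sub>R h"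
  have g: "g \<in> SO3"
    using assms by (simp add: g_def)
  have rep: "signed_rep neg l h v = (\<lambda>n. s * D_map l g v n)" for v
    by (simp add: signed_rep_def s_def g_def)
  show "inj_on (signed_rep neg l h) (coord_space (idx l))"
  proof (rule inj_on_inverseI)
    fix v assume v: "v \<in> coord_space (idx l)"
    have "D_map l (transpose g) (signed_rep neg l h v) = (\<lambda>n. s * D_map l (transpose g) (D_map l g v) n)"
      unfolding rep by (intro Hom_scale[OF D_map_Hom] Hom_coord[OF D_map_Hom] v)
    then show "(\<lambda>n. s * D_map l (transpose g) (signed_rep neg l h v) n) = v"
      using g v by (simp add: D_map_transpose s)
  qed
  have c: "D_map l (transpose g) v \<in> coord_space (idx l)"
    by (intro Hom_coord[OF D_map_Hom] assms)
  show "(\<lambda>n. (if neg then of_real (det h) else 1) * D_map l (transpose (det h *\<^sub>R h)) v n)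
      \<in> coord_space (idx l)"
    unfolding s_def[symmetric] g_def[symmetric] by (intro scale_coord_space c)
  show "signed_rep neg l h
     (\<lambda>n. (if neg then of_real (det h) else 1) * D_map l (transpose (det h *\<^sub>R h)) v n) = v"
    unfolding s_def[symmetric] g_def[symmetric] rep Hom_scale[OF D_map_Hom c]
    using g assms(3) by (simp add: D_map_transpose s)
qed

text \<open>Equivariance with the inverse moved to the other side, as an intertwining
  relation.\<close>

definition so3_steerable :: "nat \<Rightarrow> nat \<Rightarrow> kernel \<Rightarrow> bool" where
  "so3_steerable l J K \<longleftrightarrow>
     (\<forall>x. x \<notin> S2 \<longrightarrow> K x = (\<lambda>v M. 0)) \<and>
     (\<forall>x\<in>S2. K x \<in> Hom (idx l) (idx J)) \<and>
     (\<forall>g\<in>SO3. \<forall>x\<in>S2. \<forall>v\<in>coord_space (idx l). K (g *v x) (D_map l g v) = D_map J g (K x v))"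

text \<open>\<open>O3\<close> is the direct product of \<open>SO3\<close> and the group of order two
  generated by the central inversion. Steerability at the inversion is a parity condition, whose
  sign is the product of the signs by which it acts on the two spaces.\<close>

lemma steerable_kernels_iff:
  "K \<in> steerable_kernels l J (signed_rep a l) (signed_rep b J) \<longleftrightarrow>
     so3_steerable l J K \<and> (\<forall>x\<in>S2. \<forall>v M. K (- x) v M = (if a = b then 1 else - 1) * K x v M)"
proof (intro iffI conjI ballI allI)
  assume K: "K \<in> steerable_kernels l J (signed_rep a l) (signed_rep b J)"
  then have Hom: "K x \<in> Hom (idx l) (idx J)" if "x \<in> S2" for x
    using that by (simp add: steerable_kernels_def)
  have eq: "K (h *v x) v = (\<lambda>n. (if b then of_real (det h) else 1) * D_map J (det h *\<^sub>R h)
      (K x (\<lambda>n. (if a then of_real (det h) else 1) * D_map l (transpose (det h *\<^sub>R h)) v n)) n)"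
    if "h \<in> O3" "x \<in> S2" "v \<in> coord_space (idx l)" "det h = 1 \<or> det h = - 1" "det h *\<^sub>R h \<in> SO3" for h x v
    using K that by (simp add: steerable_kernels_def inv_into_signed_rep) (simp add: signed_rep_def)
  show "so3_steerable l J K"
    unfolding so3_steerable_def
  proof (intro conjI ballI)
    fix g v and x :: "real^3" assume g: "g \<in> SO3" and x: "x \<in> S2" and v: "v \<in> coord_space (idx l)"
    have "g \<in> O3"
      using SO3_D(1)[OF g] by (simp add: O3_def)
    then show "K (g *v x) (D_map l g v) = D_map J g (K x v)"
      using eq[of g x "D_map l g v"] g x v SO3_D(2)[OF g]
      by (simp add: Hom_coord[OF D_map_Hom] D_map_transpose)
  qed (use K in \<open>auto simp: steerable_kernels_def\<close>)
  fix x :: "real^3" and v M assume x: "x \<in> S2"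
  show "K (- x) v M = (if a = b then 1 else - 1) * K x v M"
  proof (cases "v \<in> coord_space (idx l)")
    case True
    define h :: "real^3^3" where "h = - mat 1"
    have "orthogonal_matrix h"
      by (simp add: h_def orthogonal_matrix_def matrix_matrix_mult_def transpose_def mat_def vec_eq_iff
          forall_3 sum_3)
    then have h: "h \<in> O3"
      by (simp add: O3_def)
    have det: "det h = - 1"
      by (simp add: h_def det_3 mat_def)
    then have scale: "det h *\<^sub>R h = mat 1"
      by (simp add: h_def)
    have hx: "h *v x = - x"
      by (simp add: h_def matrix_vector_mult_def mat_def vec_eq_iff forall_3 sum_3)
    have Kc: "K x v \<in> coord_space (idx J)"
      using Hom[OF x] True Hom_coord by blast
    \<comment> \<open>The scalars by which the inversion acts on the input and on the output space;
      their product is 1 exactly when \<open>a = b\<close>.\<close>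
    define s t :: complex where "s = (if a then - 1 else 1)" and "t = (if b then - 1 else 1)"
    have "K x (\<lambda>n. s * D_map l (mat 1) v n) = (\<lambda>M. s * K x v M)"
      unfolding D_map_id[OF True] by (rule Hom_scale[OF Hom[OF x] True])
    moreover have "D_map J (mat 1) (\<lambda>M. s * K x v M) = (\<lambda>M. s * K x v M)"
      by (rule D_map_id[OF scale_coord_space[OF Kc]])
    moreover have "K (- x) v = (\<lambda>M. t * D_map J (mat 1) (K x (\<lambda>n. s * D_map l (mat 1) v n)) M)"
    proof -
      have st: "s = (if a then of_real (det h) else 1)" "t = (if b then of_real (det h) else 1)"
        by (simp_all add: s_def t_def det)
      show ?thesis
        using eq[OF h x True, unfolded scale, OF disjI2[OF det] mat_1_SO3]
        unfolding st hx transpose_mat .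
    qed
    ultimately have "K (- x) v = (\<lambda>M. t * (s * K x v M))"
      by (simp only:)
    then have "K (- x) v M = t * (s * K x v M)"
      by (rule fun_cong)
    also have "\<dots> = (if a = b then 1 else - 1) * K x v M"
      unfolding s_def t_def by (cases a; cases b) simp_all
    finally show ?thesis .
  next
    case False
    then show ?thesis
      using Hom_outside[OF Hom] x by simp
  qed
next
  assume K: "so3_steerable l J K \<and> (\<forall>x\<in>S2. \<forall>v M. K (- x) v M = (if a = b then 1 else - 1) * K x v M)"
  then have so3: "so3_steerable l J K" and parity: "\<And>x v M. x \<in> S2 \<Longrightarrow> K (- x) v M = (if a = b then 1 else - 1) * K x v M"
    by blast+
  have Hom: "K x \<in> Hom (idx l) (idx J)" if "x \<in> S2" for x
    using that so3 by (simp add: so3_steerable_def)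
  have equiv: "D_map J g (K x (D_map l (transpose g) v)) = K (g *v x) v"
    if "g \<in> SO3" "x \<in> S2" "v \<in> coord_space (idx l)" for g x v
  proof -
    have "D_map l (transpose g) v \<in> coord_space (idx l)"
      using that by (intro Hom_coord[OF D_map_Hom])
    then have "K (g *v x) (D_map l g (D_map l (transpose g) v)) = D_map J g (K x (D_map l (transpose g) v))"
      using so3 that by (simp add: so3_steerable_def)
    then show ?thesis
      using that by (simp add: D_map_transpose)
  qed
  show "K \<in> steerable_kernels l J (signed_rep a l) (signed_rep b J)"
    unfolding steerable_kernels_def
  proof (intro CollectI conjI ballI)
    fix h v and x :: "real^3" assume h: "h \<in> O3" and x: "x \<in> S2" and v: "v \<in> coord_space (idx l)"
    define s t :: complex where "s = (if a then of_real (det h) else 1)" and "t = (if b then of_real (det h) else 1)"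
    define g where "g = det h *\<^sub>R h"
    have g: "g \<in> SO3" and d: "det h = 1 \<or> det h = - 1"
      using h by (cases rule: O3_cases; simp add: g_def)+
    have hg: "h = det h *\<^sub>R g"
      using d by (auto simp: g_def)
    have w: "D_map l (transpose g) v \<in> coord_space (idx l)"
      using v by (intro Hom_coord[OF D_map_Hom])
    then have Kw: "K x (D_map l (transpose g) v) \<in> coord_space (idx J)"
      using Hom[OF x] Hom_coord by blast
    have "(signed_rep b J h \<circ> K x \<circ> inv_into (coord_space (idx l)) (signed_rep a l h)) v
        = signed_rep b J h (K x (\<lambda>n. s * D_map l (transpose g) v n))"
      using inv_into_signed_rep[OF d _ v] g by (simp add: s_def flip: g_def)
    also have "K x (\<lambda>n. s * D_map l (transpose g) v n) = (\<lambda>M. s * K x (D_map l (transpose g) v) M)"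
      by (rule Hom_scale[OF Hom[OF x] w])
    also have "signed_rep b J h \<dots> = (\<lambda>M. t * D_map J g (\<lambda>M. s * K x (D_map l (transpose g) v) M) M)"
      by (simp add: signed_rep_def t_def g_def)
    also have "\<dots> = (\<lambda>M. t * (s * K (g *v x) v M))"
      by (simp add: Hom_scale[OF D_map_Hom Kw] equiv[OF g x v])
    \<comment> \<open>If \<open>det h = - 1\<close>, then \<open>h *v x\<close> is antipodal to
      \<open>g *v x\<close>, and the parity of \<open>K\<close> accounts for the sign
      \<open>s * t\<close>.\<close>
    also have "\<dots> = K (h *v x) v"
    proof -
      have "h *v x = det h *\<^sub>R (g *v x)"
        by (subst hg) (simp add: scaleR_matrix_vector_assoc)
      then show ?thesis
        using d parity[OF SO3_S2[OF g x]] by (auto simp: s_def t_def fun_eq_iff)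
    qed
    finally show "K (h *v x) v
        = (signed_rep b J h \<circ> K x \<circ> inv_into (coord_space (idx l)) (signed_rep a l h)) v" ..
  qed (use so3 in \<open>auto simp: so3_steerable_def\<close>)
qed

section \<open>Bases from indexed families, and dimension counting\<close>

lemma sum_kernel_apply:
  "(\<Sum>j\<in>A. kernel_scale (c j) (C j)) x v M = (\<Sum>j\<in>A. c j * C j x v M)"
  by (induction A rule: infinite_finite_induct) (simp_all add: kernel_scale_def)

text \<open>Independence of the indexed family also gives the injectivity in
  \<open>is_basis\<close>: a repeated kernel would satisfy a relation with coefficients 1 and
  -1.\<close>

lemma is_basisI:
  assumes "finite A"
    and indep: "\<And>c. (\<Sum>j\<in>A. kernel_scale (c j) (C j)) = 0 \<Longrightarrow> \<forall>j\<in>A. c j = 0"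
    and W: "\<And>K. K \<in> W \<longleftrightarrow> (\<exists>c. K = (\<Sum>j\<in>A. kernel_scale (c j) (C j)))"
  shows "is_basis A C W"
proof -
  have inj: "inj_on C A"
  proof (rule inj_onI, rule ccontr)
    fix i j assume ij: "i \<in> A" "j \<in> A" "C i = C j" "i \<noteq> j"
    define c :: "'a \<Rightarrow> complex" where "c k = (if k = i then 1 else if k = j then - 1 else 0)" for k
    have "(\<Sum>k\<in>A. kernel_scale (c k) (C k)) = (\<Sum>k\<in>{i, j}. kernel_scale (c k) (C k))"
      using \<open>finite A\<close> ij by (intro sum.mono_neutral_right) (auto simp: c_def)
    also have "\<dots> = 0"
      using ij by (simp add: c_def kernel_scale_def fun_eq_iff)
    finally have "\<forall>k\<in>A. c k = 0"
      by (rule indep)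
    then have "c i = 0"
      using ij(1) by blast
    then show False
      by (simp add: c_def)
  qed
  have sum_image: "(\<Sum>K\<in>C ` A. kernel_scale (u K) K) = (\<Sum>j\<in>A. kernel_scale (u (C j)) (C j))" for u
    by (simp add: sum.reindex[OF inj])
  have "kernel.independent (C ` A)"
  proof
    assume "kernel.dependent (C ` A)"
    then obtain u where u: "\<exists>K\<in>C ` A. u K \<noteq> 0" "(\<Sum>K\<in>C ` A. kernel_scale (u K) K) = 0"
      unfolding kernel.dependent_finite[OF finite_imageI[OF \<open>finite A\<close>]] by (elim exE conjE)
    from u(2) have "\<forall>j\<in>A. u (C j) = 0"
      unfolding sum_image by (rule indep)
    with u(1) show False
      by simp
  qed
  moreover have "kernel.span (C ` A) = W"
  proof (intro set_eqI iffI)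
    fix K assume "K \<in> kernel.span (C ` A)"
    then obtain u where "K = (\<Sum>K\<in>C ` A. kernel_scale (u K) K)"
      unfolding kernel.span_finite[OF finite_imageI[OF \<open>finite A\<close>]] by (elim rangeE)
    then show "K \<in> W"
      unfolding W sum_image by (rule exI[of _ "\<lambda>j. u (C j)"])
  next
    fix K assume "K \<in> W"
    then obtain c where "K = (\<Sum>j\<in>A. kernel_scale (c j) (C j))"
      unfolding W by (elim exE)
    then show "K \<in> kernel.span (C ` A)"
      by (simp add: kernel.span_sum kernel.span_scale kernel.span_base)
  qed
  ultimately show ?thesis
    using inj by (simp add: is_basis_def)
qed

text \<open>If \<open>w\<close> were outside the span, adjoining it would give an independent set
  with more elements than the standard basis.\<close>

lemma independent_coords_spanning:
  fixes v :: "'j \<Rightarrow> 'i \<Rightarrow> complex"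
  assumes "finite A" "finite I" "card I \<le> card A"
    and v: "\<And>j. j \<in> A \<Longrightarrow> v j \<in> coord_space I" and w: "w \<in> coord_space I"
    and indep: "\<And>c. \<forall>i. (\<Sum>j\<in>A. c j * v j i) = 0 \<Longrightarrow> \<forall>j\<in>A. c j = 0"
  shows "\<exists>c. \<forall>i. w i = (\<Sum>j\<in>A. c j * v j i)"
proof -
  define scale where "scale c f = (\<lambda>i. c * f i)" for c :: complex and f :: "'i \<Rightarrow> complex"
  interpret V: vector_space scale
    by unfold_locales (auto simp: scale_def fun_eq_iff algebra_simps)
  have sum_apply: "(\<Sum>a\<in>B. scale (c a) (f a)) i = (\<Sum>a\<in>B. c a * f a i)" for B :: "'b set" and c f i
    by (induction B rule: infinite_finite_induct) (simp_all add: scale_def)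
  have inj: "inj_on v A"
  proof (rule inj_onI, rule ccontr)
    fix i j assume ij: "i \<in> A" "j \<in> A" "v i = v j" "i \<noteq> j"
    define c :: "'j \<Rightarrow> complex" where "c k = (if k = i then 1 else if k = j then - 1 else 0)" for k
    have "(\<Sum>k\<in>A. c k * v k n) = (\<Sum>k\<in>{i, j}. c k * v k n)" for n
      using \<open>finite A\<close> ij by (intro sum.mono_neutral_right) (auto simp: c_def)
    also have "(\<Sum>k\<in>{i, j}. c k * v k n) = 0" for n
      using ij by (simp add: c_def)
    finally have "\<forall>n. (\<Sum>k\<in>A. c k * v k n) = 0"
      by blast
    then have "\<forall>k\<in>A. c k = 0"
      by (rule indep)
    then have "c i = 0"
      using ij(1) by blast
    then show False
      by (simp add: c_def)
  qed
  have ind: "V.independent (v ` A)"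
  proof
    assume "V.dependent (v ` A)"
    then obtain u where u: "\<exists>f\<in>v ` A. u f \<noteq> 0" "(\<Sum>f\<in>v ` A. scale (u f) f) = 0"
      unfolding V.dependent_finite[OF finite_imageI[OF \<open>finite A\<close>]] by (elim exE conjE)
    have "(\<Sum>f\<in>v ` A. u f * f i) = 0" for i
      using sum_apply[of u "\<lambda>f. f" "v ` A" i] by (simp add: u(2))
    then have "\<forall>i. (\<Sum>j\<in>A. u (v j) * v j i) = 0"
      by (simp add: sum.reindex[OF inj])
    then have "\<forall>j\<in>A. u (v j) = 0"
      by (rule indep)
    with u(1) show False
      by simp
  qed
  have coord: "f \<in> V.span (std_basis ` I)" if "f \<in> coord_space I" for f
  proof -
    have f: "f = (\<Sum>i\<in>I. scale (f i) (std_basis i))"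
      unfolding fun_eq_iff sum_apply
      using fun_cong[OF coord_space_expansion[OF \<open>finite I\<close> that]] by (rule allI)
    have "(\<Sum>i\<in>I. scale (f i) (std_basis i)) \<in> V.span (std_basis ` I)"
      by (intro V.span_sum V.span_scale V.span_base imageI)
    then show ?thesis
      unfolding f[symmetric] .
  qed
  have "w \<in> V.span (v ` A)"
  proof (rule ccontr)
    assume notin: "w \<notin> V.span (v ` A)"
    then have "V.independent (insert w (v ` A))"
      using ind by (rule V.independent_insertI)
    moreover have "insert w (v ` A) \<subseteq> V.span (std_basis ` I)"
      using coord v w by auto
    ultimately have "card (insert w (v ` A)) \<le> card (std_basis ` I)"
      using V.independent_span_bound \<open>finite I\<close> by blast
    also have "\<dots> \<le> card I"
      using \<open>finite I\<close> by (rule card_image_le)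
    finally have "card (insert w (v ` A)) \<le> card I" .
    moreover have "w \<notin> v ` A"
      using notin V.span_base by blast
    ultimately show False
      using assms(1,3) by (simp add: card_image[OF inj])
  qed
  then obtain u where "w = (\<Sum>f\<in>v ` A. scale (u f) f)"
    unfolding V.span_finite[OF finite_imageI[OF \<open>finite A\<close>]] by (elim rangeE)
  then have "w i = (\<Sum>f\<in>v ` A. u f * f i)" for i
    by (simp only: sum_apply)
  then have "\<forall>i. w i = (\<Sum>j\<in>A. u (v j) * v j i)"
    by (simp add: sum.reindex[OF inj])
  then show ?thesis
    by (rule exI[of _ "\<lambda>j. u (v j)"])
qed

section \<open>Steerable kernels at the north pole\<close>

lemma so3_steerable_pole_offdiag:
  assumes K: "so3_steerable l J K" and n: "n \<in> idx l" and "M \<noteq> n"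
  shows "K pole (std_basis n) M = 0"
proof -
  \<comment> \<open>Rotations about the polar axis fix the pole, so \<open>K pole\<close> commutes
    with their diagonal action. This angle makes the phases of orders \<open>n\<close> and
    \<open>M\<close> opposite.\<close>
  define \<phi> where "\<phi> = pi / of_int (n - M)"
  have "rot_z \<phi> *v pole = pole"
    by (simp add: vec_eq_iff forall_3 pole_def)
  moreover have e: "std_basis n \<in> coord_space (idx l)"
    using n by (rule std_basis_coord_space)
  ultimately have eq: "K pole (D_map l (rot_z \<phi>) (std_basis n)) = D_map J (rot_z \<phi>) (K pole (std_basis n))"
    using K rot_z_SO3 pole_S2 unfolding so3_steerable_def by metis
  have Hom: "K pole \<in> Hom (idx l) (idx J)"
    using K pole_S2 by (simp add: so3_steerable_def)
  have w: "K pole (std_basis n) \<in> coord_space (idx J)"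
    using Hom e by (rule Hom_coord)
  have rot: "D_map k (rot_z \<phi>) v m = cis (- (of_int m * \<phi>)) * v m"
    if "v \<in> coord_space (idx k)" for k v m
  proof -
    have "D_map k (rot_z \<phi>) v m = (\<Sum>n\<in>idx k. if m = n then cis (- (of_int m * \<phi>)) * v m else 0)"
      unfolding D_map_apply[OF rot_z_SO3 that] by (intro sum.cong) (auto simp: wigner_D_rot_z)
    then show ?thesis
      using that by (simp add: coord_space_def)
  qed
  have "D_map l (rot_z \<phi>) (std_basis n) = (\<lambda>i. cis (- (of_int n * \<phi>)) * std_basis n i)"
    unfolding fun_eq_iff rot[OF e] by (simp add: std_basis_def)
  then have "cis (- (of_int n * \<phi>)) * K pole (std_basis n) M = cis (- (of_int M * \<phi>)) * K pole (std_basis n) M"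
    using eq Hom_scale[OF Hom e] rot[OF w] by metis
  moreover have "cis (- (of_int n * \<phi>)) \<noteq> cis (- (of_int M * \<phi>))"
  proof
    assume "cis (- (of_int n * \<phi>)) = cis (- (of_int M * \<phi>))"
    then have "cis (of_int n * \<phi>) * cis (- (of_int n * \<phi>)) = cis (of_int n * \<phi>) * cis (- (of_int M * \<phi>))"
      by simp
    then have "1 = cis (of_int (n - M) * \<phi>)"
      by (simp add: cis_mult algebra_simps)
    also have "of_int (n - M) * \<phi> = pi"
      using \<open>M \<noteq> n\<close> by (simp add: \<phi>_def)
    finally show False by simp
  qed
  ultimately show ?thesis by simp
qed

text \<open>Off-diagonal entries at the pole vanish in any case, and diagonal positions exist only
  for orders common to \<open>idx l\<close> and \<open>idx J\<close>. Rotations carry the pole to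
  every point of the sphere, and equivariance carries the vanishing along.\<close>

lemma so3_steerable_eq_0:
  assumes K: "so3_steerable l J K"
    and diag: "\<And>n. n \<in> idx (min l J) \<Longrightarrow> K pole (std_basis n) n = 0"
  shows "K = 0"
proof -
  have Hom: "K x \<in> Hom (idx l) (idx J)" if "x \<in> S2" for x
    using K that by (simp add: so3_steerable_def)
  have basis: "K pole (std_basis n) M = 0" if n: "n \<in> idx l" for n M
  proof (cases "M = n \<and> M \<in> idx J")
    case True
    then show ?thesis
      using n diag[of n] by (auto simp: idx_def min_def)
  next
    case False
    then show ?thesis
      using so3_steerable_pole_offdiag[OF K n, of M]
        Hom_coord[OF Hom[OF pole_S2] std_basis_coord_space[OF n]] by (auto simp: coord_space_def)
  qed
  then have pole: "K pole v = (\<lambda>M. 0)" if "v \<in> coord_space (idx l)" for v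
    using Hom_expansion[OF Hom[OF pole_S2] _ that] by auto
  have "K x v M = 0" for x v M
  proof (cases "x \<in> S2 \<and> v \<in> coord_space (idx l)")
    case True
    then obtain \<alpha> \<beta> where x: "x = (rot_z \<alpha> ** rot_y \<beta>) *v pole"
      using S2_euler by blast
    define g where "g = rot_z \<alpha> ** rot_y \<beta>"
    have g: "g \<in> SO3"
      unfolding g_def by (intro SO3_mult rot_z_SO3 rot_y_SO3)
    have w: "D_map l (transpose g) v \<in> coord_space (idx l)"
      using True Hom_coord[OF D_map_Hom] by blast
    have "K (g *v pole) (D_map l g (D_map l (transpose g) v)) = D_map J g (K pole (D_map l (transpose g) v))"
      using K g w pole_S2 unfolding so3_steerable_def by blast
    also have "\<dots> = D_map J g (\<lambda>M. 0)"
      using pole[OF w] by simp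
    also have "\<dots> = (\<lambda>M. 0)"
      by (simp add: fun_eq_iff D_map_apply[OF g] coord_space_def)
    finally show ?thesis
      using True g x by (simp add: D_map_transpose flip: g_def)
  next
    case False
    then show ?thesis
      using K Hom_outside[OF Hom, of x v] unfolding so3_steerable_def by (cases "x \<in> S2") auto
  qed
  then show ?thesis
    by (simp add: fun_eq_iff)
qed

section \<open>Linear combinations of steerable kernels\<close>

lemma so3_steerable_add:
  assumes "so3_steerable l J K" "so3_steerable l J K'"
  shows "so3_steerable l J (K + K')"
proof -
  have "(\<lambda>v. K x v + K' x v) \<in> Hom (idx l) (idx J)" if "x \<in> S2" for x
  proof -
    have "K x \<in> Hom (idx l) (idx J)" "K' x \<in> Hom (idx l) (idx J)"
      using assms that by (simp_all add: so3_steerable_def)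
    then show ?thesis
      unfolding Hom_def by (auto simp: coord_space_def fun_eq_iff algebra_simps)
  qed
  moreover have "D_map J g (K x v + K' x v) = D_map J g (K x v) + D_map J g (K' x v)"
    if "x \<in> S2" "v \<in> coord_space (idx l)" for g x v
  proof -
    have "K x v \<in> coord_space (idx J)" "K' x v \<in> coord_space (idx J)"
      using assms that Hom_coord unfolding so3_steerable_def by blast+
    then show ?thesis
      using D_map_Hom[of J g] unfolding Hom_def plus_fun_def by blast
  qed
  ultimately show ?thesis
    using assms unfolding so3_steerable_def by (simp add: plus_fun_def zero_fun_def)
qed

lemma so3_steerable_scale:
  assumes "so3_steerable l J K"
  shows "so3_steerable l J (kernel_scale c K)"
proof -
  have "(\<lambda>v M. c * K x v M) \<in> Hom (idx l) (idx J)" if "x \<in> S2" for x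
  proof -
    have "K x \<in> Hom (idx l) (idx J)"
      using assms that by (simp add: so3_steerable_def)
    then show ?thesis
      unfolding Hom_def by (auto simp: coord_space_def fun_eq_iff algebra_simps)
  qed
  moreover have "D_map J g (\<lambda>M. c * K x v M) = (\<lambda>M. c * D_map J g (K x v) M)"
    if "x \<in> S2" "v \<in> coord_space (idx l)" for g x v
  proof (rule Hom_scale[OF D_map_Hom])
    show "K x v \<in> coord_space (idx J)"
      using assms that Hom_coord unfolding so3_steerable_def by blast
  qed
  ultimately show ?thesis
    using assms unfolding so3_steerable_def kernel_scale_def by simp
qed

lemma so3_steerable_0: "so3_steerable l J 0"
  by (auto simp: so3_steerable_def Hom_def coord_space_def zero_fun_def fun_eq_iff D_map_def lin_map_def)

lemma so3_steerable_sum: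
  assumes "\<And>j. j \<in> A \<Longrightarrow> so3_steerable l J (C j)"
  shows "so3_steerable l J (\<Sum>j\<in>A. kernel_scale (c j) (C j))"
  using assms
  by (induction A rule: infinite_finite_induct)
     (simp_all add: so3_steerable_0 so3_steerable_add so3_steerable_scale)

section \<open>Clebsch-Gordan kernels\<close>

text \<open>The conjugate appears since \<open>herm_inner\<close> is antilinear in its first
  argument, where the embedding stands.\<close>

lemma clebsch_gordan_eq:
  assumes "m \<in> idx j" "n \<in> idx l"
  shows "clebsch_gordan j l \<iota> M m n = cnj (\<iota> (std_basis M) (m, n))"
proof -
  have "clebsch_gordan j l \<iota> M m n
      = (\<Sum>p\<in>idx j \<times> idx l. if p = (m, n) then cnj (\<iota> (std_basis M) (m, n)) else 0)"
    unfolding clebsch_gordan_def herm_inner_def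
    by (intro sum.cong) (auto simp: tensor_def std_basis_def split: if_splits)
  then show ?thesis
    using assms by simp
qed

lemma CG_embedding_intertwines:
  assumes \<iota>: "CG_embedding J j l \<iota>" and g: "g \<in> SO3"
    and "m \<in> idx j" "n \<in> idx l" "M \<in> idx J"
  shows "(\<Sum>M'\<in>idx J. wigner_D J g M' M * \<iota> (std_basis M') (m, n))
    = (\<Sum>m'\<in>idx j. \<Sum>n'\<in>idx l. wigner_D j g m m' * wigner_D l g n n' * \<iota> (std_basis M) (m', n'))"
proof -
  have Hom: "\<iota> \<in> Hom (idx J) (idx j \<times> idx l)"
    using \<iota> by (simp add: CG_embedding_def)
  have e: "std_basis M \<in> coord_space (idx J)"
    using assms by (intro std_basis_coord_space)
  have "D_map J g (std_basis M) M' = wigner_D J g M' M" for M'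
  proof -
    have "D_map J g (std_basis M) M' = (\<Sum>N\<in>idx J. if N = M then wigner_D J g M' M else 0)"
      unfolding D_map_apply[OF g e] by (intro sum.cong) (auto simp: std_basis_def)
    then show ?thesis
      using assms by simp
  qed
  then have "(\<Sum>M'\<in>idx J. wigner_D J g M' M * \<iota> (std_basis M') (m, n))
      = \<iota> (D_map J g (std_basis M)) (m, n)"
    using Hom_expansion[OF Hom finite_idx Hom_coord[OF D_map_Hom e]] by simp
  also have "\<iota> (D_map J g (std_basis M)) = D_tensor_map j l g (\<iota> (std_basis M))"
    using \<iota> g e by (simp add: CG_embedding_def)
  also have "\<dots> (m, n)
      = (\<Sum>m'\<in>idx j. \<Sum>n'\<in>idx l. wigner_D j g m m' * wigner_D l g n n' * \<iota> (std_basis M) (m', n'))"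
    using Hom_coord[OF Hom e] assms
    by (simp add: D_tensor_map_def lin_map_def sum.cartesian_product case_prod_unfold)
  finally show ?thesis .
qed

definition CG_matrix ::
    "nat \<Rightarrow> nat \<Rightarrow> ((int \<Rightarrow> complex) \<Rightarrow> (int \<times> int \<Rightarrow> complex)) \<Rightarrow> real^3 \<Rightarrow> int \<Rightarrow> int \<Rightarrow> complex" where
  "CG_matrix j l \<iota> x M n = (\<Sum>m\<in>idx j. clebsch_gordan j l \<iota> M m n * cnj (sph_harm j m x))"

lemma CG_kernel_eq: "x \<in> S2 \<Longrightarrow> CG_kernel l J j \<iota> x = lin_map (idx l) (idx J) (CG_matrix j l \<iota> x)"
  by (simp add: CG_kernel_def CG_matrix_def[abs_def])

lemma CG_matrix_cnj:
  "n \<in> idx l \<Longrightarrow> cnj (CG_matrix j l \<iota> x M n) = (\<Sum>m\<in>idx j. \<iota> (std_basis M) (m, n) * sph_harm j m x)"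
  by (simp add: CG_matrix_def clebsch_gordan_eq)

text \<open>Conjugation leaves unconjugated coordinates of the embedding and spherical harmonics. By
  unitarity the conjugated Wigner entries belong to the transpose of \<open>g\<close>, and the claim
  becomes the intertwining property of the embedding for that rotation.\<close>

lemma CG_matrix_equivariant:
  assumes \<iota>: "CG_embedding J j l \<iota>" and g: "g \<in> SO3" and x: "x \<in> S2"
    and M: "M \<in> idx J" and n: "n \<in> idx l"
  shows "(\<Sum>n'\<in>idx l. CG_matrix j l \<iota> (g *v x) M n' * wigner_D l g n' n)
    = (\<Sum>M'\<in>idx J. wigner_D J g M M' * CG_matrix j l \<iota> x M' n)"
proof -
  let ?h = "transpose g"
  let ?T = "\<lambda>m n M. \<iota> (std_basis M) (m, n)"
  have h: "?h \<in> SO3"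
    using g by (rule SO3_transpose)
  have adj: "cnj (wigner_D k g a b) = wigner_D k ?h b a" for k a b
    using wigner_D_transpose[OF g, of k b a] by simp
  have "cnj (\<Sum>n'\<in>idx l. CG_matrix j l \<iota> (g *v x) M n' * wigner_D l g n' n)
      = (\<Sum>n'\<in>idx l. (\<Sum>m\<in>idx j. ?T m n' M * (\<Sum>m'\<in>idx j. wigner_D j ?h m' m * sph_harm j m' x))
          * wigner_D l ?h n n')"
    using g x by (simp add: CG_matrix_cnj sph_harm_SO3 adj cong: sum.cong)
  also have "\<dots> = (\<Sum>n'\<in>idx l. \<Sum>m\<in>idx j. \<Sum>m'\<in>idx j.
      wigner_D j ?h m' m * wigner_D l ?h n n' * ?T m n' M * sph_harm j m' x)"
    unfolding sum_distrib_left sum_distrib_right by (intro sum.cong refl) (simp add: mult_ac)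
  also have "\<dots> = (\<Sum>n'\<in>idx l. \<Sum>m'\<in>idx j. \<Sum>m\<in>idx j.
      wigner_D j ?h m' m * wigner_D l ?h n n' * ?T m n' M * sph_harm j m' x)"
    by (intro sum.cong refl sum.swap)
  also have "\<dots> = (\<Sum>m'\<in>idx j. \<Sum>n'\<in>idx l. \<Sum>m\<in>idx j.
      wigner_D j ?h m' m * wigner_D l ?h n n' * ?T m n' M * sph_harm j m' x)"
    by (rule sum.swap)
  also have "\<dots> = (\<Sum>m'\<in>idx j. \<Sum>m\<in>idx j. \<Sum>n'\<in>idx l.
      wigner_D j ?h m' m * wigner_D l ?h n n' * ?T m n' M * sph_harm j m' x)"
    by (intro sum.cong refl sum.swap)
  also have "\<dots> = (\<Sum>m'\<in>idx j. (\<Sum>m\<in>idx j. \<Sum>n'\<in>idx l.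
      wigner_D j ?h m' m * wigner_D l ?h n n' * ?T m n' M) * sph_harm j m' x)"
    by (simp only: sum_distrib_right)
  \<comment> \<open>The inner double sum is the tensor product action on
    \<open>\<iota> (std_basis M)\<close>, which the embedding exchanges for the action on
    \<open>std_basis M\<close>.\<close>
  also have "\<dots> = (\<Sum>m'\<in>idx j. (\<Sum>M'\<in>idx J. wigner_D J ?h M' M * ?T m' n M') * sph_harm j m' x)"
    using CG_embedding_intertwines[OF \<iota> h _ n M] by (intro sum.cong refl) simp
  also have "\<dots> = (\<Sum>m'\<in>idx j. \<Sum>M'\<in>idx J. wigner_D J ?h M' M * (?T m' n M' * sph_harm j m' x))"
    by (simp only: sum_distrib_right mult.assoc)
  also have "\<dots> = (\<Sum>M'\<in>idx J. \<Sum>m'\<in>idx j. wigner_D J ?h M' M * (?T m' n M' * sph_harm j m' x))"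
    by (rule sum.swap)
  also have "\<dots> = cnj (\<Sum>M'\<in>idx J. wigner_D J g M M' * CG_matrix j l \<iota> x M' n)"
    using n by (simp add: CG_matrix_cnj adj sum_distrib_left)
  finally show ?thesis
    by (simp only: complex_cnj_cancel_iff)
qed

lemma CG_kernel_so3_steerable:
  assumes \<iota>: "CG_embedding J j l \<iota>"
  shows "so3_steerable l J (CG_kernel l J j \<iota>)"
  unfolding so3_steerable_def
proof (intro conjI ballI allI impI)
  fix g v and x :: "real^3" assume g: "g \<in> SO3" and x: "x \<in> S2" and v: "v \<in> coord_space (idx l)"
  have gx: "g *v x \<in> S2"
    using g x by (rule SO3_S2)
  have Dv: "D_map l g v \<in> coord_space (idx l)"
    using v by (rule Hom_coord[OF D_map_Hom])
  have w: "lin_map (idx l) (idx J) (CG_matrix j l \<iota> x) v \<in> coord_space (idx J)"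
    using v by (rule Hom_coord[OF lin_map_in_Hom])
  show "CG_kernel l J j \<iota> (g *v x) (D_map l g v) = D_map J g (CG_kernel l J j \<iota> x v)"
    unfolding CG_kernel_eq[OF gx] CG_kernel_eq[OF x]
  proof
    fix M
    show "lin_map (idx l) (idx J) (CG_matrix j l \<iota> (g *v x)) (D_map l g v) M
        = D_map J g (lin_map (idx l) (idx J) (CG_matrix j l \<iota> x) v) M"
    proof (cases "M \<in> idx J")
      case True
      have "lin_map (idx l) (idx J) (CG_matrix j l \<iota> (g *v x)) (D_map l g v) M
          = (\<Sum>n'\<in>idx l. \<Sum>n\<in>idx l. CG_matrix j l \<iota> (g *v x) M n' * wigner_D l g n' n * v n)"
        using True Dv by (simp add: lin_map_def D_map_apply[OF g v] sum_distrib_left mult.assoc)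
      also have "\<dots> = (\<Sum>n\<in>idx l. (\<Sum>n'\<in>idx l. CG_matrix j l \<iota> (g *v x) M n' * wigner_D l g n' n) * v n)"
        by (subst sum.swap) (simp only: sum_distrib_right)
      also have "\<dots> = (\<Sum>n\<in>idx l. (\<Sum>M'\<in>idx J. wigner_D J g M M' * CG_matrix j l \<iota> x M' n) * v n)"
        using CG_matrix_equivariant[OF \<iota> g x True] by (intro sum.cong refl) simp
      also have "\<dots> = (\<Sum>M'\<in>idx J. \<Sum>n\<in>idx l. wigner_D J g M M' * (CG_matrix j l \<iota> x M' n * v n))"
        by (subst sum.swap) (simp only: sum_distrib_right mult.assoc)
      also have "\<dots> = D_map J g (lin_map (idx l) (idx J) (CG_matrix j l \<iota> x) v) M"
        unfolding D_map_apply[OF g w] sum_distrib_left[symmetric]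
        using v by (intro sum.cong refl) (simp add: lin_map_def)
      finally show ?thesis .
    next
      case False
      then show ?thesis
        using Hom_coord[OF D_map_Hom w, of g] by (simp add: coord_space_def lin_map_def)
    qed
  qed
qed (simp_all add: CG_kernel_def lin_map_in_Hom)

lemma CG_kernel_uminus:
  assumes "x \<in> S2"
  shows "CG_kernel l J j \<iota> (- x) v M = (- 1) ^ j * CG_kernel l J j \<iota> x v M"
proof -
  have "CG_matrix j l \<iota> (- x) = (\<lambda>M n. (- 1) ^ j * CG_matrix j l \<iota> x M n)"
    using assms by (auto simp: CG_matrix_def fun_eq_iff sph_harm_uminus sum_distrib_left mult_ac intro!: sum.cong)
  moreover have "- x \<in> S2"
    using assms by simp
  ultimately show ?thesis
    using assms by (simp add: CG_kernel_eq lin_map_def sum_distrib_left mult.assoc)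
qed

text \<open>Isometry gives \<open>\<iota> j (std_basis 0)\<close> a nonzero coordinate at some
  \<open>(m, n)\<close>. In the conjugated entry of the relation at row 0 and column
  \<open>n\<close>, \<open>sph_harm j m\<close> has as coefficient \<open>cnj (c j)\<close> times
  that coordinate, and the spherical harmonics of all degrees are independent.\<close>

lemma CG_kernels_independent:
  assumes "finite A" and \<iota>: "\<And>j. j \<in> A \<Longrightarrow> CG_embedding J j l (\<iota> j)"
    and zero: "(\<Sum>j\<in>A. kernel_scale (c j) (CG_kernel l J j (\<iota> j))) = 0"
  shows "\<forall>j\<in>A. c j = 0"
proof
  fix j assume j: "j \<in> A"
  \<comment> \<open>Order 0 lies in \<open>idx J\<close> for every \<open>J\<close>, so
    \<open>std_basis 0\<close> is always an available unit vector.\<close>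
  define T where "T i m n = \<iota> i (std_basis 0) (m, n)" for i m n
  have e0: "std_basis 0 \<in> coord_space (idx J)"
    by (simp add: std_basis_coord_space idx_def)
  have "herm_inner (idx j \<times> idx l) (\<iota> j (std_basis 0)) (\<iota> j (std_basis 0))
      = herm_inner (idx J) (std_basis 0) (std_basis 0)"
    using \<iota>[OF j] e0 by (simp add: CG_embedding_def)
  also have "\<dots> = (\<Sum>i\<in>idx J. if i = 0 then 1 else 0)"
    unfolding herm_inner_def by (intro sum.cong) (auto simp: std_basis_def)
  also have "\<dots> = 1"
    by (simp add: idx_def)
  finally have "\<exists>p\<in>idx j \<times> idx l. \<iota> j (std_basis 0) p \<noteq> 0"
    unfolding herm_inner_def by (metis (no_types, lifting) mult_zero_right sum.neutral zero_neq_one)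
  then obtain m n where mn: "m \<in> idx j" "n \<in> idx l" "T j m n \<noteq> 0"
    by (auto simp: T_def)
  obtain L where L: "\<And>i. i \<in> A \<Longrightarrow> i \<le> L"
    using \<open>finite A\<close> finite_nat_set_iff_bounded_le by auto
  \<comment> \<open>Extended by zero to degrees outside \<open>A\<close>, since
    \<open>sph_harm_independent\<close> sums over all degrees up to \<open>L\<close>.\<close>
  define a where "a i k = (if i \<in> A then cnj (c i) * T i k n else 0)" for i k
  have "(\<Sum>i\<le>L. \<Sum>k\<in>idx i. a i k * sph_harm i k x) = 0" if x: "x \<in> S2" for x
  proof -
    have "CG_kernel l J i (\<iota> i) x (std_basis n) 0 = CG_matrix i l (\<iota> i) x 0 n" for i
      unfolding CG_kernel_eq[OF x] lin_map_def using std_basis_coord_space[OF mn(2)] mn(2)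
      by (simp add: idx_def[of J]) (simp add: std_basis_def if_distrib cong: if_cong)
    then have "(\<Sum>i\<in>A. c i * CG_matrix i l (\<iota> i) x 0 n) = 0"
      using sum_kernel_apply[of c "\<lambda>j. CG_kernel l J j (\<iota> j)" A x "std_basis n" 0] zero by simp
    then have "0 = cnj (\<Sum>i\<in>A. c i * CG_matrix i l (\<iota> i) x 0 n)"
      by simp
    also have "\<dots> = (\<Sum>i\<in>A. \<Sum>k\<in>idx i. a i k * sph_harm i k x)"
      using mn(2) by (simp add: CG_matrix_cnj a_def T_def sum_distrib_left mult.assoc)
    also have "\<dots> = (\<Sum>i\<le>L. \<Sum>k\<in>idx i. a i k * sph_harm i k x)"
      using L by (intro sum.mono_neutral_left) (auto simp: a_def)
    finally show ?thesis ..
  qed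
  from sph_harm_independent[OF this L[OF j] mn(1)] have "a j m = 0" .
  then show "c j = 0"
    using j mn(3) by (simp add: a_def)
qed

section \<open>Counting dimensions and selecting parities\<close>

definition CG_degrees :: "nat \<Rightarrow> nat \<Rightarrow> nat set" where
  "CG_degrees l J = {j. \<bar>int l - int J\<bar> \<le> int j \<and> j \<le> l + J}"

lemma finite_CG_degrees: "finite (CG_degrees l J)"
  by (rule finite_subset[of _ "{..l + J}"]) (auto simp: CG_degrees_def)

text \<open>Both sides are \<open>2 * min l J + 1\<close>: as many kernels are available as there
  are diagonal entries at the pole.\<close>

lemma card_CG_degrees: "card (CG_degrees l J) = card (idx (min l J))"
proof -
  have "CG_degrees l J = {nat \<bar>int l - int J\<bar>..l + J}"
    by (auto simp: CG_degrees_def)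
  then show ?thesis
    by (auto simp: idx_def)
qed

text \<open>The diagonal at the pole is linear and injective on steerable kernels, so the diagonals
  of the independent kernels \<open>CG_kernel\<close> are independent. By cardinality they span, and
  coefficients found for the diagonal of \<open>K\<close> are valid for \<open>K\<close>
  itself.\<close>

lemma so3_steerable_spanned:
  assumes \<iota>: "\<And>j. j \<in> CG_degrees l J \<Longrightarrow> CG_embedding J j l (\<iota> j)" and K: "so3_steerable l J K"
  obtains c where "K = (\<Sum>j\<in>CG_degrees l J. kernel_scale (c j) (CG_kernel l J j (\<iota> j)))"
proof -
  let ?A = "CG_degrees l J" and ?I = "idx (min l J)" and ?C = "\<lambda>j. CG_kernel l J j (\<iota> j)"
  define diag where "diag K = (\<lambda>n. if n \<in> ?I then K pole (std_basis n) n else 0)" for K :: kernel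
  have diag_coord: "diag K \<in> coord_space ?I" for K
    by (simp add: diag_def coord_space_def)
  have diag_sum: "diag (\<Sum>j\<in>?A. kernel_scale (c j) (?C j)) n = (\<Sum>j\<in>?A. c j * diag (?C j) n)" for c n
    by (simp add: diag_def sum_kernel_apply)
  have steer: "so3_steerable l J (\<Sum>j\<in>?A. kernel_scale (c j) (?C j))" for c
    using \<iota> by (intro so3_steerable_sum CG_kernel_so3_steerable)
  have diag_0: "K' = 0" if "so3_steerable l J K'" "\<And>n. diag K' n = 0" for K'
    using that by (intro so3_steerable_eq_0[OF that(1)]) (metis diag_def)
  have "\<exists>c. \<forall>n. diag K n = (\<Sum>j\<in>?A. c j * diag (?C j) n)"
  proof (rule independent_coords_spanning[where I = ?I])
    fix c assume c: "\<forall>n. (\<Sum>j\<in>?A. c j * diag (?C j) n) = 0"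
    have "(\<Sum>j\<in>?A. kernel_scale (c j) (?C j)) = 0"
      by (rule diag_0[OF steer]) (simp only: diag_sum c)
    then show "\<forall>j\<in>?A. c j = 0"
      using \<iota> by (intro CG_kernels_independent[OF finite_CG_degrees])
  qed (simp_all add: diag_coord finite_CG_degrees card_CG_degrees)
  then obtain c where c: "\<And>n. diag K n = (\<Sum>j\<in>?A. c j * diag (?C j) n)"
    by blast
  define S where "S = (\<Sum>j\<in>?A. kernel_scale (c j) (?C j))"
  \<comment> \<open>The difference is written with \<open>kernel_scale (- 1)\<close> so that the
    closure lemmas apply; its diagonal vanishes.\<close>
  have "K + kernel_scale (- 1) S = 0"
  proof (rule diag_0)
    show "so3_steerable l J (K + kernel_scale (- 1) S)"
      unfolding S_def by (intro so3_steerable_add so3_steerable_scale steer K)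
    have "diag (K + kernel_scale (- 1) S) n = diag K n - diag S n" for n
      by (simp add: diag_def kernel_scale_def)
    then show "diag (K + kernel_scale (- 1) S) n = 0" for n
      by (simp add: c S_def diag_sum)
  qed
  then have "K = S"
    by (simp add: kernel_scale_def fun_eq_iff)
  then show ?thesis
    using that S_def by blast
qed

text \<open>Inversion of \<open>x\<close> multiplies the \<open>j\<close>-th term of an expansion by
  \<open>(- 1) ^ j\<close>, so the parity condition forces every coefficient with the wrong sign to
  vanish.\<close>

lemma CG_kernels_basis:
  assumes \<iota>: "\<And>j. j \<in> CG_degrees l J \<Longrightarrow> CG_embedding J j l (\<iota> j)"
  shows "is_basis {j \<in> CG_degrees l J. even j \<longleftrightarrow> a = b} (\<lambda>j. CG_kernel l J j (\<iota> j))
    (steerable_kernels l J (signed_rep a l) (signed_rep b J))"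
proof (rule is_basisI)
  let ?A = "CG_degrees l J" and ?C = "\<lambda>j. CG_kernel l J j (\<iota> j)"
  define B where "B = {j \<in> ?A. even j \<longleftrightarrow> a = b}"
  define \<epsilon> :: complex where "\<epsilon> = (if a = b then 1 else - 1)"
  show "finite {j \<in> ?A. even j \<longleftrightarrow> a = b}"
    by (simp add: finite_CG_degrees)
  have sign: "(- 1) ^ j = \<epsilon> \<longleftrightarrow> j \<in> B" if "j \<in> ?A" for j
    using that by (cases "even j") (auto simp: B_def \<epsilon>_def)
  show "\<forall>j\<in>{j \<in> ?A. even j \<longleftrightarrow> a = b}. c j = 0"
    if "(\<Sum>j\<in>{j \<in> ?A. even j \<longleftrightarrow> a = b}. kernel_scale (c j) (?C j)) = 0" for c
    using \<iota> that by (intro CG_kernels_independent) (auto simp: finite_CG_degrees)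
  show "K \<in> steerable_kernels l J (signed_rep a l) (signed_rep b J) \<longleftrightarrow>
      (\<exists>c. K = (\<Sum>j\<in>{j \<in> ?A. even j \<longleftrightarrow> a = b}. kernel_scale (c j) (?C j)))" for K
    unfolding steerable_kernels_iff B_def[symmetric] \<epsilon>_def[symmetric]
  proof (intro iffI)
    assume K: "so3_steerable l J K \<and> (\<forall>x\<in>S2. \<forall>v M. K (- x) v M = \<epsilon> * K x v M)"
    then obtain c where c: "K = (\<Sum>j\<in>?A. kernel_scale (c j) (?C j))"
      using so3_steerable_spanned[OF \<iota>] by blast
    \<comment> \<open>The parity condition \<open>K (- x) = \<epsilon> * K x\<close> rewritten as a
      linear relation among all the kernels.\<close>
    have "(\<Sum>j\<in>?A. c j * ((- 1) ^ j - \<epsilon>) * ?C j x v M) = 0" for x v M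
    proof (cases "x \<in> S2")
      case True
      have "(\<Sum>j\<in>?A. c j * ((- 1) ^ j - \<epsilon>) * ?C j x v M) = K (- x) v M - \<epsilon> * K x v M"
        unfolding c sum_kernel_apply CG_kernel_uminus[OF True]
        by (simp add: sum_distrib_left sum_subtractf[symmetric] algebra_simps)
      then show ?thesis
        using K True by simp
    qed (simp add: CG_kernel_def)
    then have "(\<Sum>j\<in>?A. kernel_scale (c j * ((- 1) ^ j - \<epsilon>)) (?C j)) = 0"
      unfolding fun_eq_iff sum_kernel_apply by simp
    then have "\<forall>j\<in>?A. c j * ((- 1) ^ j - \<epsilon>) = 0"
      using \<iota> by (intro CG_kernels_independent[OF finite_CG_degrees])
    then have "c j = 0" if "j \<in> ?A - B" for j
      using that sign[of j] by auto
    then have "K = (\<Sum>j\<in>B. kernel_scale (c j) (?C j))"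
      unfolding c by (intro sum.mono_neutral_right finite_CG_degrees) (auto simp: B_def)
    then show "\<exists>c. K = (\<Sum>j\<in>B. kernel_scale (c j) (?C j))"
      by (rule exI[of _ c])
  next
    assume "\<exists>c. K = (\<Sum>j\<in>B. kernel_scale (c j) (?C j))"
    then obtain c where c: "K = (\<Sum>j\<in>B. kernel_scale (c j) (?C j))"
      by (elim exE)
    have "so3_steerable l J K"
      unfolding c using \<iota> by (intro so3_steerable_sum CG_kernel_so3_steerable) (simp add: B_def)
    moreover have "K (- x) v M = \<epsilon> * K x v M" if "x \<in> S2" for x v M
      unfolding c sum_kernel_apply CG_kernel_uminus[OF that] sum_distrib_left
      using sign by (intro sum.cong) (auto simp: B_def)
    ultimately show "so3_steerable l J K \<and> (\<forall>x\<in>S2. \<forall>v M. K (- x) v M = \<epsilon> * K x v M)"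
      by blast
  qed
qed

theorem mainTheorem8:
  fixes l J :: nat
    and \<iota> :: "nat \<Rightarrow> (int \<Rightarrow> complex) \<Rightarrow> (int \<times> int \<Rightarrow> complex)"
  assumes "\<And>j. \<bar>int l - int J\<bar> \<le> int j \<Longrightarrow> j \<le> l + J \<Longrightarrow> CG_embedding J j l (\<iota> j)"
  shows
    "is_basis {j. \<bar>int l - int J\<bar> \<le> int j \<and> j \<le> l + J \<and> even j} (\<lambda>j. CG_kernel l J j (\<iota> j))
       (steerable_kernels l J (rep_plus l) (rep_plus J)) \<and>
     is_basis {j. \<bar>int l - int J\<bar> \<le> int j \<and> j \<le> l + J \<and> odd j} (\<lambda>j. CG_kernel l J j (\<iota> j))
       (steerable_kernels l J (rep_plus l) (rep_minus J)) \<and>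
     is_basis {j. \<bar>int l - int J\<bar> \<le> int j \<and> j \<le> l + J \<and> odd j} (\<lambda>j. CG_kernel l J j (\<iota> j))
       (steerable_kernels l J (rep_minus l) (rep_plus J)) \<and>
     is_basis {j. \<bar>int l - int J\<bar> \<le> int j \<and> j \<le> l + J \<and> even j} (\<lambda>j. CG_kernel l J j (\<iota> j))
       (steerable_kernels l J (rep_minus l) (rep_minus J))"
proof -
  have \<iota>: "CG_embedding J j l (\<iota> j)" if "j \<in> CG_degrees l J" for j
    using that assms by (simp add: CG_degrees_def)
  note basis = CG_kernels_basis[of l J \<iota>, OF \<iota>]
  show ?thesis
    \<comment> \<open>Equal flags select the even degrees and different flags the odd ones.\<close>
    using basis[of False False] basis[of False True] basis[of True False] basis[of True True]
    by (simp add: signed_rep_False signed_rep_True CG_degrees_def conj_assoc)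
qed

end
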